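(* Assume $F$ is globally Lipschitz and $a:\mathbb{R}^n\to[0,\infty)$ is continuous with $D:=\{a=0\}\neq\emptyset$, and fix $\rho>0$. Then $\lim_{\beta\to\infty}\inf_{\mathcal{U}_\rho}\mathcal{F}^\beta_\rho=\inf_{\mathcal{U}_\rho}\mathcal{F}_\rho$. Moreover, if $\mathcal{F}_\rho\not\equiv+\infty$ and for each $\beta>0$ $\hat u_\beta$ is a minimizer of $\mathcal{F}^\beta_\rho$ (minimizers exist), then for every non-decreasing sequence $\beta_m\to+\infty$ the sequence $(\hat u_{\beta_m})_{m\ge1}$ is pre-compact in the strong $L^2$ topology, and each of its strong limit points is a minimizer of $\mathcal{F}_\rho$.
   Context: $x_0\in\mathbb{R}^n$ fixed; $\mathcal{U}=L^2([0,1],\mathbb{R}^k)$; $x_u$ solves $\dot x_u=F(x_u)u$, $x_u(0)=x_0$. $\mathcal{U}_\rho=\{u\in\mathcal{U}:\|u\|_{L^2}\le\rho\}$. $\mathcal{F}^\beta_\rho$ is the restriction to $\mathcal{U}_\rho$ of $\mathcal{F}^\beta(u)=\frac12\|u\|_{L^2}^2+\beta a(x_u(1))$. $\mathcal{F}_\rho:\mathcal{U}_\rho\to[0,+\infty]$ is $\mathcal{F}_\rho(u)=\frac12\|u\|_{L^2}^2$ if $x_u(1)\in D$, and $+\infty$ otherwise. *)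

theory Defs
  imports "HOL-Analysis.Analysis"
begin

definition L2 :: "(real \<Rightarrow> 'a::euclidean_space) set" where
  "L2 = {u. u \<in> borel_measurable (lebesgue_on {0..1}) \<and>
            integrable (lebesgue_on {0..1}) (\<lambda>t. (norm (u t))^2)}"

definition L2norm :: "(real \<Rightarrow> 'a::euclidean_space) \<Rightarrow> real" where
  "L2norm u = sqrt (integral\<^sup>L (lebesgue_on {0..1}) (\<lambda>t. (norm (u t))^2))"

definition Uball :: "real \<Rightarrow> (real \<Rightarrow> 'a::euclidean_space) set" where
  "Uball \<rho> = {u \<in> L2. L2norm u \<le> \<rho>}"

text \<open>Final state x_u(1) of the (Caratheodory) solution of x' = F(x) u, x(0) = x0,
  i.e. x t = x0 + integral over [0,t] of F(x s) u(s), for t in [0,1].\<close>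
definition endpoint :: "real^'n \<Rightarrow> (real^'n \<Rightarrow> real^'k^'n) \<Rightarrow> (real \<Rightarrow> real^'k) \<Rightarrow> real^'n" where
  "endpoint x0 F u = (THE y. \<exists>x. x 0 = x0 \<and>
      (\<forall>t\<in>{0..1}. ((\<lambda>s. F (x s) *v u s) has_integral (x t - x0)) {0..t}) \<and> y = x 1)"

definition Fbeta :: "real^'n \<Rightarrow> (real^'n \<Rightarrow> real^'k^'n) \<Rightarrow> (real^'n \<Rightarrow> real) \<Rightarrow> real
                     \<Rightarrow> (real \<Rightarrow> real^'k) \<Rightarrow> real" where
  "Fbeta x0 F a \<beta> u = 1/2 * (L2norm u)^2 + \<beta> * a (endpoint x0 F u)"

definition Frho :: "real^'n \<Rightarrow> (real^'n \<Rightarrow> real^'k^'n) \<Rightarrow> (real^'n \<Rightarrow> real)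
                     \<Rightarrow> (real \<Rightarrow> real^'k) \<Rightarrow> ereal" where
  "Frho x0 F a u = (if endpoint x0 F u \<in> {x. a x = 0} then ereal (1/2 * (L2norm u)^2) else \<infinity>)"

end

(*
  The dynamics are not convex, but only convexity of the L2 norm is needed. Given controls u_j in a
  ball, Arzela-Ascoli yields a uniformly convergent subsequence of trajectories x_j -> x. The set K_n
  is the midpoint hull of {u_j | j >= n}; elements v_n of K_n of nearly minimal norm form a Cauchy
  sequence by the parallelogram law, with a strong limit w whose norm is the limit of the minimal
  norms. Since the integrals of F(x) u_j over [0,t] converge to x(t) - x0, so do those of F(x) v_n,
  hence x is the trajectory of w. This provides the compactness and lower semicontinuity that one
  usually takes from the weak topology. For minimizers of the penalized functionals the norms of the
  u_j do not exceed that of w, which is also the limit of the minimal norms over the K_n; the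
  parallelogram law then makes the u_j themselves Cauchy.
*)
theory Submission
  imports Defs "HOL-Complex_Analysis.Great_Picard"
begin

section \<open>The space L2\<close>

lemma L2_iff:
  "u \<in> L2 \<longleftrightarrow> u \<in> borel_measurable (lebesgue_on {0..1}) \<and> (\<lambda>t. (norm (u t))\<^sup>2) integrable_on {0..1}"
proof -
  have "integrable (lebesgue_on {0..1}) (\<lambda>t. (norm (u t))\<^sup>2) \<longleftrightarrow> (\<lambda>t. (norm (u t))\<^sup>2) integrable_on {0..1}"
    by (metis (no_types, lifting) absolutely_integrable_imp_integrable absolutely_integrable_on_iff_nonneg
        integrable_on_lebesgue_on lmeasurable_interval(1) fmeasurableD
        zero_le_power2)
  then show ?thesis by (simp add: L2_def)
qed

lemma L2norm_sq:
  assumes "u \<in> L2"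
  shows "(L2norm u)\<^sup>2 = integral {0..1} (\<lambda>t. (norm (u t))\<^sup>2)"
proof -
  have "integrable (lebesgue_on {0..1}) (\<lambda>t. (norm (u t))\<^sup>2)"
    using assms by (simp add: L2_def)
  then have "integral\<^sup>L (lebesgue_on {0..1}) (\<lambda>t. (norm (u t))\<^sup>2) = integral {0..1} (\<lambda>t. (norm (u t))\<^sup>2)"
    by (intro lebesgue_integral_eq_integral) auto
  moreover have "0 \<le> integral\<^sup>L (lebesgue_on {0..1}) (\<lambda>t. (norm (u t))\<^sup>2)"
    by (intro Bochner_Integration.integral_nonneg) auto
  ultimately show ?thesis by (simp add: L2norm_def)
qed

lemma L2norm_nonneg [simp]: "0 \<le> L2norm u"
  unfolding L2norm_def by (intro real_sqrt_ge_zero Bochner_Integration.integral_nonneg) auto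

lemma L2_scaleR: "u \<in> L2 \<Longrightarrow> (\<lambda>t. c *\<^sub>R u t) \<in> L2"
  unfolding L2_def mem_Collect_eq norm_scaleR power_mult_distrib
  by (intro conjI borel_measurable_scaleR integrable_mult_right) auto

lemma L2_add:
  assumes "u \<in> L2" "v \<in> L2"
  shows "(\<lambda>t. u t + v t) \<in> L2"
proof -
  have m: "(\<lambda>t. u t + v t) \<in> borel_measurable (lebesgue_on {0..1})"
    using assms by (auto simp: L2_def)
  have pt: "(norm (u t + v t))\<^sup>2 \<le> 2 * (norm (u t))\<^sup>2 + 2 * (norm (v t))\<^sup>2" for t
  proof -
    have "(norm (u t + v t))\<^sup>2 + (norm (u t - v t))\<^sup>2 = 2 * (norm (u t))\<^sup>2 + 2 * (norm (v t))\<^sup>2"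
      by (simp add: power2_norm_eq_inner algebra_simps)
    then show ?thesis
      using zero_le_power2[of "norm (u t - v t)"] by linarith
  qed
  have "integrable (lebesgue_on {0..1}) (\<lambda>t. (norm (u t + v t))\<^sup>2)"
  proof (rule measurable_bounded_by_integrable_imp_lebesgue_integrable)
    show "integrable (lebesgue_on {0..1}) (\<lambda>t. 2 * (norm (u t))\<^sup>2 + 2 * (norm (v t))\<^sup>2)"
      using assms unfolding L2_def by (intro Bochner_Integration.integrable_add integrable_mult_right) auto
    show "(\<lambda>t. (norm (u t + v t))\<^sup>2) \<in> borel_measurable (lebesgue_on {0..1})"
      using m by measurable
  qed (use pt in auto)
  with m show ?thesis by (simp add: L2_def)
qed

lemma L2_diff:
  assumes "u \<in> L2" "v \<in> L2"
  shows "(\<lambda>t. u t - v t) \<in> L2"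
  using L2_add[OF assms(1) L2_scaleR[OF assms(2), of "-1"]] by (simp only: scaleR_minus1_left add_uminus_conv_diff)

lemma L2norm_scaleR: "u \<in> L2 \<Longrightarrow> L2norm (\<lambda>t. c *\<^sub>R u t) = \<bar>c\<bar> * L2norm u"
  by (simp add: L2norm_def power_mult_distrib real_sqrt_mult)

lemma L2norm_diff_commute: "L2norm (\<lambda>t. u t - v t) = L2norm (\<lambda>t. v t - u t)"
  by (simp add: L2norm_def norm_minus_commute)

lemma L2norm_parallelogram:
  assumes "u \<in> L2" "v \<in> L2"
  shows "(L2norm (\<lambda>t. u t - v t))\<^sup>2 =
    2 * (L2norm u)\<^sup>2 + 2 * (L2norm v)\<^sup>2 - 4 * (L2norm (\<lambda>t. (1/2) *\<^sub>R (u t + v t)))\<^sup>2"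
proof -
  let ?I = "integral {0..1}"
  have i: "(\<lambda>t. (norm (u t))\<^sup>2) integrable_on {0..1}" "(\<lambda>t. (norm (v t))\<^sup>2) integrable_on {0..1}"
    "(\<lambda>t. (norm (u t + v t))\<^sup>2) integrable_on {0..1}"
    using assms L2_add[OF assms] by (auto simp: L2_iff)
  have "(norm (x - y))\<^sup>2 = 2 * (norm x)\<^sup>2 + 2 * (norm y)\<^sup>2 - (norm (x + y))\<^sup>2" for x y :: 'a
    by (simp add: power2_norm_eq_inner algebra_simps inner_commute)
  then have "(L2norm (\<lambda>t. u t - v t))\<^sup>2 =
      ?I (\<lambda>t. 2 * (norm (u t))\<^sup>2 + 2 * (norm (v t))\<^sup>2 - (norm (u t + v t))\<^sup>2)"
    using L2norm_sq[OF L2_diff[OF assms]] by simp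
  also have "\<dots> = 2 * ?I (\<lambda>t. (norm (u t))\<^sup>2) + 2 * ?I (\<lambda>t. (norm (v t))\<^sup>2) - ?I (\<lambda>t. (norm (u t + v t))\<^sup>2)"
    using i by (simp add: Henstock_Kurzweil_Integration.integral_diff Henstock_Kurzweil_Integration.integral_add integrable_add)
  finally show ?thesis
    by (simp add: L2norm_sq assms L2_add L2norm_scaleR power_mult_distrib power_divide)
qed

lemma L2norm_triangle:
  assumes "u \<in> L2" "v \<in> L2"
  shows "L2norm (\<lambda>t. u t + v t) \<le> L2norm u + L2norm v"
proof (rule field_le_epsilon)
  fix e :: real assume "0 < e"
  define a where "a = L2norm u + e/2"
  define b where "b = L2norm v + e/2"
  have ab: "0 < a" "0 < b" "L2norm u \<le> a" "L2norm v \<le> b"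
    using \<open>0 < e\<close> by (auto simp: a_def b_def add_nonneg_pos)
  let ?I = "integral {0..1}"
  have i: "(\<lambda>t. (norm (u t))\<^sup>2) integrable_on {0..1}" "(\<lambda>t. (norm (v t))\<^sup>2) integrable_on {0..1}"
    "(\<lambda>t. (norm (u t + v t))\<^sup>2) integrable_on {0..1}"
    using assms L2_add[OF assms] by (auto simp: L2_iff)
  have pt: "(norm (x + y))\<^sup>2 \<le> (1 + b/a) * (norm x)\<^sup>2 + (1 + a/b) * (norm y)\<^sup>2" for x y :: 'a
  proof -
    have "(norm (x + y))\<^sup>2 \<le> (norm x + norm y)\<^sup>2"
      by (simp add: norm_triangle_ineq power_mono)
    moreover have "0 \<le> (b * norm x - a * norm y)\<^sup>2 / (a * b)"
      using ab by simp
    moreover have "(b * norm x - a * norm y)\<^sup>2 / (a * b) = b/a * (norm x)\<^sup>2 + a/b * (norm y)\<^sup>2 - 2 * norm x * norm y"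
      using ab by (simp add: field_simps power2_eq_square)
    ultimately show ?thesis by (simp add: power2_sum algebra_simps)
  qed
  have "(L2norm (\<lambda>t. u t + v t))\<^sup>2 = ?I (\<lambda>t. (norm (u t + v t))\<^sup>2)"
    by (simp add: L2norm_sq L2_add assms)
  also have "\<dots> \<le> ?I (\<lambda>t. (1 + b/a) * (norm (u t))\<^sup>2 + (1 + a/b) * (norm (v t))\<^sup>2)"
    using i by (intro integral_le pt integrable_add integrable_on_mult_right)
  also have "\<dots> = (1 + b/a) * (L2norm u)\<^sup>2 + (1 + a/b) * (L2norm v)\<^sup>2"
    using i assms
    by (simp add: L2norm_sq Henstock_Kurzweil_Integration.integral_add integrable_on_mult_right
        del: distrib_right_numeral)
  also have "\<dots> \<le> (1 + b/a) * a\<^sup>2 + (1 + a/b) * b\<^sup>2"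
    using ab by (intro add_mono mult_left_mono power_mono) auto
  also have "\<dots> = (a + b)\<^sup>2"
    using ab by (simp add: field_simps power2_eq_square)
  finally have "L2norm (\<lambda>t. u t + v t) \<le> a + b"
    by (rule power2_le_imp_le) (use ab in simp)
  then show "L2norm (\<lambda>t. u t + v t) \<le> L2norm u + L2norm v + e"
    by (simp add: a_def b_def)
qed

lemma L2_absolutely_integrable:
  assumes "u \<in> L2" "0 \<le> s" "t \<le> 1"
  shows "u absolutely_integrable_on {s..t}"
proof -
  have pt: "norm x \<le> 1 + (norm x)\<^sup>2" for x :: 'a
    using sum_power2_ge_zero[of "norm x - 1/2" "sqrt (3/4)"] by (simp add: power2_eq_square algebra_simps)
  have "u absolutely_integrable_on {0..1}"
  proof (rule measurable_bounded_by_integrable_imp_absolutely_integrable)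
    show "(\<lambda>t. 1 + (norm (u t))\<^sup>2) integrable_on {0..1}"
      using assms by (intro integrable_add) (auto simp: L2_iff)
  qed (use assms pt in \<open>auto simp: L2_iff\<close>)
  then show ?thesis
    using assms absolutely_integrable_on_subinterval[of "{0..1}" u] by auto
qed

lemma L2_norm_integrable:
  assumes "u \<in> L2" "0 \<le> s" "t \<le> 1"
  shows "(\<lambda>t. norm (u t)) integrable_on {s..t}"
  using L2_absolutely_integrable[OF assms] absolutely_integrable_on_def by blast

lemma integral_norm_le:
  assumes "u \<in> L2" "0 \<le> s" "s \<le> t" "t \<le> 1" "0 < \<eta>"
  shows "integral {s..t} (\<lambda>t. norm (u t)) \<le> (t - s) / (2 * \<eta>) + \<eta> / 2 * (L2norm u)\<^sup>2"
proof -
  have pt: "norm x \<le> 1 / (2 * \<eta>) + \<eta> / 2 * (norm x)\<^sup>2" for x :: 'a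
  proof -
    have "0 \<le> (\<eta> * norm x - 1)\<^sup>2 / (2 * \<eta>)" using assms by simp
    also have "\<dots> = 1 / (2 * \<eta>) + \<eta> / 2 * (norm x)\<^sup>2 - norm x"
      using assms by (simp add: field_simps power2_eq_square)
    finally show ?thesis by simp
  qed
  have i: "(\<lambda>t. (norm (u t))\<^sup>2) integrable_on {0..1}" using assms by (simp add: L2_iff)
  then have i': "(\<lambda>t. (norm (u t))\<^sup>2) integrable_on {s..t}"
    using assms by (intro integrable_on_subinterval[OF i]) auto
  have "integral {s..t} (\<lambda>t. norm (u t)) \<le> integral {s..t} (\<lambda>t. 1 / (2 * \<eta>) + \<eta> / 2 * (norm (u t))\<^sup>2)"
    using i' assms by (intro integral_le L2_norm_integrable pt integrable_add integrable_on_mult_right) auto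
  also have "\<dots> = (t - s) / (2 * \<eta>) + \<eta> / 2 * integral {s..t} (\<lambda>t. (norm (u t))\<^sup>2)"
  proof -
    have "integral {s..t} (\<lambda>_. 1 / (2 * \<eta>)) = (t - s) / (2 * \<eta>)"
      using assms by simp
    then show ?thesis
      using i' Henstock_Kurzweil_Integration.integral_mult_right[of "{s..t}" "\<eta> / 2" "\<lambda>t. (norm (u t))\<^sup>2"]
        Henstock_Kurzweil_Integration.integral_add[of "\<lambda>_. 1 / (2 * \<eta>)" "{s..t}" "\<lambda>t. \<eta> / 2 * (norm (u t))\<^sup>2"]
        integrable_on_mult_right[OF i', of "\<eta> / 2"] by (simp only: integrable_const_ivl)
  qed
  also have "integral {s..t} (\<lambda>t. (norm (u t))\<^sup>2) \<le> (L2norm u)\<^sup>2"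
    unfolding L2norm_sq[OF assms(1)] using i i' assms by (intro integral_subset_le) auto
  finally show ?thesis using assms by simp
qed

lemma integral_norm_le_L2norm:
  assumes u: "u \<in> L2" and st: "0 \<le> s" "s \<le> t" "t \<le> 1"
  shows "integral {s..t} (\<lambda>r. norm (u r)) \<le> L2norm u"
proof (rule field_le_epsilon)
  fix e :: real assume "0 < e"
  define a where "a = L2norm u + e"
  have a: "0 < a" "L2norm u \<le> a" using \<open>0 < e\<close> by (auto simp: a_def add_nonneg_pos)
  have "integral {s..t} (\<lambda>r. norm (u r)) \<le> (t - s) / (2 * (1 / a)) + 1 / a / 2 * (L2norm u)\<^sup>2"
    using a by (intro integral_norm_le u st) auto
  also have "\<dots> \<le> 1 / (2 * (1 / a)) + 1 / a / 2 * a\<^sup>2"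
    using a st by (intro add_mono divide_right_mono mult_left_mono power_mono) auto
  also have "\<dots> = a" using a by (simp add: power2_eq_square)
  finally show "integral {s..t} (\<lambda>r. norm (u r)) \<le> L2norm u + e" by (simp add: a_def)
qed

lemma AE_summable_norm:
  fixes f :: "nat \<Rightarrow> 'a \<Rightarrow> 'b::{banach, second_countable_topology}"
  assumes int: "\<And>k. integrable M (f k)"
    and le: "\<And>k. (\<integral>x. norm (f k x) \<partial>M) \<le> c k" and "summable c"
  shows "AE x in M. summable (\<lambda>k. norm (f k x))"
proof -
  have [measurable]: "f k \<in> borel_measurable M" for k using int by auto
  have c0: "0 \<le> c k" for k
    by (rule order_trans[OF _ le]) simp
  have "(\<integral>\<^sup>+x. (\<Sum>k. ennreal (norm (f k x))) \<partial>M) = (\<Sum>k. \<integral>\<^sup>+x. ennreal (norm (f k x)) \<partial>M)"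
    by (rule nn_integral_suminf) simp
  also have "\<dots> = (\<Sum>k. ennreal (\<integral>x. norm (f k x) \<partial>M))"
    using int by (simp add: nn_integral_eq_integral)
  also have "\<dots> \<le> (\<Sum>k. ennreal (c k))"
    using le by (intro suminf_le ennreal_leI) auto
  also have "\<dots> < top"
    using c0 \<open>summable c\<close> by (simp add: suminf_ennreal2)
  finally have "AE x in M. (\<Sum>k. ennreal (norm (f k x))) \<noteq> \<infinity>"
    by (intro nn_integral_PInf_AE) auto
  then show ?thesis
    by eventually_elim (auto intro: summable_suminf_not_top)
qed

lemma L2_closed_AE_limit:
  assumes w: "\<And>k. w k \<in> L2" and lim: "AE t in lebesgue_on {0..1}. (\<lambda>k. w k t) \<longlonglongrightarrow> u t"
    and u: "u \<in> borel_measurable (lebesgue_on {0..1})"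
    and b: "\<And>k. L2norm (w k) \<le> c"
  shows "u \<in> L2 \<and> L2norm u \<le> c"
proof -
  let ?M = "lebesgue_on {0..1}"
  have [measurable]: "w k \<in> borel_measurable ?M" "u \<in> borel_measurable ?M" for k
    using w[of k] u by (auto simp: L2_def)
  have c: "0 \<le> c" using b[of 0] L2norm_nonneg[of "w 0"] by linarith
  have "(\<integral>\<^sup>+t. ennreal ((norm (u t))\<^sup>2) \<partial>?M) = (\<integral>\<^sup>+t. liminf (\<lambda>k. ennreal ((norm (w k t))\<^sup>2)) \<partial>?M)"
  proof (rule nn_integral_cong_AE)
    show "AE t in ?M. ennreal ((norm (u t))\<^sup>2) = liminf (\<lambda>k. ennreal ((norm (w k t))\<^sup>2))"
      using lim
    proof eventually_elim
      case (elim t)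
      then have "(\<lambda>k. ennreal ((norm (w k t))\<^sup>2)) \<longlonglongrightarrow> ennreal ((norm (u t))\<^sup>2)"
        by (intro tendsto_ennrealI tendsto_power tendsto_norm)
      then show ?case by (metis lim_imp_Liminf sequentially_bot)
    qed
  qed
  also have "\<dots> \<le> liminf (\<lambda>k. \<integral>\<^sup>+t. ennreal ((norm (w k t))\<^sup>2) \<partial>?M)"
    by (rule nn_integral_liminf) simp
  also have "\<dots> \<le> liminf (\<lambda>k. ennreal (c\<^sup>2))"
  proof (intro Liminf_mono always_eventually allI)
    fix k
    have i: "integrable ?M (\<lambda>t. (norm (w k t))\<^sup>2)"
      using w[of k] by (simp add: L2_def)
    have "(\<integral>\<^sup>+t. ennreal ((norm (w k t))\<^sup>2) \<partial>?M) = ennreal ((L2norm (w k))\<^sup>2)"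
      using nn_integral_eq_integral[OF i] Bochner_Integration.integral_nonneg[of ?M "\<lambda>t. (norm (w k t))\<^sup>2"]
      by (simp add: L2norm_def)
    also have "\<dots> \<le> ennreal (c\<^sup>2)"
      using b[of k] by (intro ennreal_leI power_mono) auto
    finally show "(\<integral>\<^sup>+t. ennreal ((norm (w k t))\<^sup>2) \<partial>?M) \<le> ennreal (c\<^sup>2)" .
  qed
  also have "\<dots> = ennreal (c\<^sup>2)"
    by (simp add: Liminf_const)
  finally have le: "(\<integral>\<^sup>+t. ennreal ((norm (u t))\<^sup>2) \<partial>?M) \<le> ennreal (c\<^sup>2)" .
  have i: "integrable ?M (\<lambda>t. (norm (u t))\<^sup>2)"
    by (rule integrableI_bounded) (use le in \<open>auto intro: le_less_trans\<close>)
  then have "ennreal (integral\<^sup>L ?M (\<lambda>t. (norm (u t))\<^sup>2)) \<le> ennreal (c\<^sup>2)"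
    using le by (simp add: nn_integral_eq_integral)
  then have "integral\<^sup>L ?M (\<lambda>t. (norm (u t))\<^sup>2) \<le> c\<^sup>2"
    by (simp add: ennreal_le_iff)
  then have "L2norm u \<le> c"
    unfolding L2norm_def using c by (metis real_sqrt_le_mono real_sqrt_unique)
  with i u show ?thesis by (simp add: L2_def)
qed

lemma Cauchy_fast_subseq:
  fixes d :: "nat \<Rightarrow> nat \<Rightarrow> real"
  assumes "\<And>e. 0 < e \<Longrightarrow> \<exists>N. \<forall>m\<ge>N. \<forall>n\<ge>N. d m n < e"
  obtains r :: "nat \<Rightarrow> nat" where "strict_mono r" "\<And>k m n. r k \<le> m \<Longrightarrow> r k \<le> n \<Longrightarrow> d m n < (1/2)^k"
proof -
  have "\<exists>N. \<forall>m\<ge>N. \<forall>n\<ge>N. d m n < (1/2)^k" for k by (rule assms) simp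
  then obtain N where N: "\<And>k m n. N k \<le> m \<Longrightarrow> N k \<le> n \<Longrightarrow> d m n < (1/2)^k" by metis
  define r where "r = rec_nat (N 0) (\<lambda>k x. Suc (max x (N (Suc k))))"
  have "strict_mono r"
    by (rule strict_mono_Suc_iff[THEN iffD2]) (auto simp: r_def less_Suc_eq_le)
  moreover have "N k \<le> r k" for k by (cases k) (auto simp: r_def)
  ultimately show ?thesis using that[of r] N by (meson order_trans)
qed

lemma L2_complete:
  fixes v :: "nat \<Rightarrow> real \<Rightarrow> 'a::euclidean_space"
  assumes v: "\<And>n. v n \<in> L2"
    and Cauchy: "\<And>e. 0 < e \<Longrightarrow> \<exists>N. \<forall>m\<ge>N. \<forall>n\<ge>N. L2norm (\<lambda>t. v m t - v n t) < e"
  obtains u where "u \<in> L2" "(\<lambda>n. L2norm (\<lambda>t. v n t - u t)) \<longlonglongrightarrow> 0"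
proof -
  let ?M = "lebesgue_on {0..1}"
  obtain r :: "nat \<Rightarrow> nat" where r: "strict_mono r"
    and d: "\<And>k m n. r k \<le> m \<Longrightarrow> r k \<le> n \<Longrightarrow> L2norm (\<lambda>t. v m t - v n t) < (1/2)^k"
    using Cauchy_fast_subseq[of "\<lambda>m n. L2norm (\<lambda>t. v m t - v n t)"] Cauchy by blast
  define w where "w k = v (r k)" for k
  have w: "w k \<in> L2" for k using v by (simp add: w_def)
  have dw: "(\<lambda>t. w (Suc k) t - w k t) \<in> L2" for k by (intro L2_diff w)
  have "AE t in ?M. summable (\<lambda>k. norm (w (Suc k) t - w k t))"
  proof (rule AE_summable_norm)
    fix k
    show i: "integrable ?M (\<lambda>t. w (Suc k) t - w k t)"
      by (rule absolutely_integrable_imp_integrable[OF L2_absolutely_integrable[OF dw]]) auto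
    let ?q = "L2norm (\<lambda>t. w (Suc k) t - w k t)"
    have q: "?q \<le> (1/2)^k"
      unfolding w_def by (rule less_imp_le[OF d]) (use r in \<open>auto simp: strict_mono_less_eq\<close>)
    have "(\<integral>t. norm (w (Suc k) t - w k t) \<partial>?M) = integral {0..1} (\<lambda>t. norm (w (Suc k) t - w k t))"
      by (rule lebesgue_integral_eq_integral) (use i in auto)
    also have "\<dots> \<le> (1 - 0) / (2 * 2^k) + 2^k / 2 * ?q\<^sup>2"
      by (rule integral_norm_le[OF dw]) auto
    also have "\<dots> \<le> (1 - 0) / (2 * 2^k) + 2^k / 2 * ((1/2)^k)\<^sup>2"
      using q by (intro add_left_mono mult_left_mono power_mono) auto
    also have "\<dots> = (1/2)^k"
      by (simp add: power2_eq_square power_divide field_simps)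
    finally show "(\<integral>t. norm (w (Suc k) t - w k t) \<partial>?M) \<le> (1/2)^k" .
  qed (simp add: summable_geometric)
  then have conv: "AE t in ?M. convergent (\<lambda>k. w k t)"
  proof eventually_elim
    case (elim t)
    then have "summable (\<lambda>k. w (Suc k) t - w k t)" by (rule summable_norm_cancel)
    then have "convergent (\<lambda>n. (\<Sum>k<n. w (Suc k) t - w k t))" by (simp add: summable_iff_convergent)
    then have "convergent (\<lambda>n. (\<Sum>k<n. w (Suc k) t - w k t) + w 0 t)"
      by (intro convergent_add convergent_const)
    then show ?case unfolding sum_lessThan_telescope[of "\<lambda>k. w k t"] by simp
  qed
  define u where "u t = lim (\<lambda>k. w k t)" for t
  have lim: "AE t in ?M. (\<lambda>k. w k t) \<longlonglongrightarrow> u t"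
    using conv by eventually_elim (simp add: u_def convergent_LIMSEQ_iff)
  have wm: "w k \<in> borel_measurable ?M" for k using w[of k] by (simp add: L2_def)
  have um: "u \<in> borel_measurable ?M"
    unfolding u_def by (rule borel_measurable_lim_metric) (rule wm)
  have *: "(\<lambda>t. v n t - u t) \<in> L2 \<and> L2norm (\<lambda>t. v n t - u t) \<le> (1/2)^k" if n: "r k \<le> n" for k n
  proof (rule L2_closed_AE_limit[where w = "\<lambda>j t. v n t - w (j + k) t"])
    show "(\<lambda>t. v n t - w (j + k) t) \<in> L2" for j by (intro L2_diff v w)
    show "AE t in ?M. (\<lambda>j. v n t - w (j + k) t) \<longlonglongrightarrow> v n t - u t"
      using lim by eventually_elim (intro tendsto_diff tendsto_const LIMSEQ_ignore_initial_segment)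
    show "(\<lambda>t. v n t - u t) \<in> borel_measurable ?M"
      using v[of n] um by (auto simp: L2_def)
    show "L2norm (\<lambda>t. v n t - w (j + k) t) \<le> (1/2)^k" for j
      unfolding w_def
      by (rule less_imp_le[OF d]) (use r n in \<open>auto simp: strict_mono_less_eq\<close>)
  qed
  have "(\<lambda>t. v (r 0) t - (v (r 0) t - u t)) \<in> L2"
    by (rule L2_diff[OF v conjunct1[OF *[OF order_refl]]])
  then have "u \<in> L2" by simp
  moreover have "(\<lambda>n. L2norm (\<lambda>t. v n t - u t)) \<longlonglongrightarrow> 0"
  proof (rule LIMSEQ_I)
    fix e :: real assume "0 < e"
    then obtain k where "(1/2)^k < e" using real_arch_pow_inv[of e "1/2"] by auto
    then show "\<exists>N. \<forall>n\<ge>N. norm (L2norm (\<lambda>t. v n t - u t) - 0) < e"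
      using * by (intro exI[of _ "r k"]) (fastforce intro: le_less_trans)
  qed
  ultimately show ?thesis by (rule that)
qed

section \<open>Strong limits from midpoint hulls\<close>

inductive_set midhull :: "(real \<Rightarrow> 'a::real_vector) set \<Rightarrow> (real \<Rightarrow> 'a) set" for S where
  base: "u \<in> S \<Longrightarrow> u \<in> midhull S"
| mid: "u \<in> midhull S \<Longrightarrow> v \<in> midhull S \<Longrightarrow> (\<lambda>t. (1/2) *\<^sub>R (u t + v t)) \<in> midhull S"

lemma midhull_mono: "S \<subseteq> T \<Longrightarrow> midhull S \<subseteq> midhull T"
proof
  fix u assume "S \<subseteq> T" and "u \<in> midhull S"
  from this(2) show "u \<in> midhull T"
    by induction (use \<open>S \<subseteq> T\<close> in \<open>auto intro: midhull.intros\<close>)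
qed

lemma L2norm_mid_le:
  assumes "u \<in> L2" "v \<in> L2" "L2norm u \<le> c" "L2norm v \<le> c"
  shows "L2norm (\<lambda>t. (1/2) *\<^sub>R (u t + v t)) \<le> c"
  using L2norm_triangle[OF assms(1,2)] assms by (simp add: L2norm_scaleR L2_add)

lemma midhull_L2:
  assumes "\<And>u. u \<in> S \<Longrightarrow> u \<in> L2 \<and> L2norm u \<le> c" and "u \<in> midhull S"
  shows "u \<in> L2 \<and> L2norm u \<le> c"
  using assms(2) by induction (auto simp: assms(1) L2norm_mid_le intro!: L2_scaleR L2_add)

lemma tendsto_L2norm:
  assumes "\<And>n. v n \<in> L2" "u \<in> L2" "(\<lambda>n. L2norm (\<lambda>t. v n t - u t)) \<longlonglongrightarrow> 0"
  shows "(\<lambda>n. L2norm (v n)) \<longlonglongrightarrow> L2norm u"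
proof -
  have "\<bar>L2norm (v n) - L2norm u\<bar> \<le> L2norm (\<lambda>t. v n t - u t)" for n
    using L2norm_triangle[OF L2_diff[OF assms(1)[of n] assms(2)] assms(2)]
      L2norm_triangle[OF L2_diff[OF assms(2) assms(1)[of n]] assms(1)[of n]]
    by (simp add: L2norm_diff_commute[of u])
  then have "(\<lambda>n. L2norm (v n) - L2norm u) \<longlonglongrightarrow> 0"
    by (intro Lim_null_comparison[OF _ assms(3)] always_eventually) simp
  then show ?thesis by (simp add: LIM_zero_iff)
qed

lemma L2_Cauchy_if_norms:
  fixes v :: "nat \<Rightarrow> real \<Rightarrow> 'a::euclidean_space"
  assumes v: "\<And>n. v n \<in> L2" and le: "\<And>n. (L2norm (v n))\<^sup>2 \<le> c n" and c: "c \<longlonglongrightarrow> l"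
    and d: "d \<longlonglongrightarrow> l"
    and mid: "\<And>j m n. j \<le> m \<Longrightarrow> j \<le> n \<Longrightarrow> d j \<le> (L2norm (\<lambda>t. (1/2) *\<^sub>R (v m t + v n t)))\<^sup>2"
    and "0 < e"
  shows "\<exists>N. \<forall>m\<ge>N. \<forall>n\<ge>N. L2norm (\<lambda>t. v m t - v n t) < e"
proof -
  have "0 < e\<^sup>2 / 16" using \<open>0 < e\<close> by simp
  with c d obtain N1 N2 where N1: "\<And>n. N1 \<le> n \<Longrightarrow> \<bar>c n - l\<bar> < e\<^sup>2 / 16"
    and N2: "\<And>n. N2 \<le> n \<Longrightarrow> \<bar>d n - l\<bar> < e\<^sup>2 / 16"
    unfolding LIMSEQ_iff real_norm_def by meson
  have "L2norm (\<lambda>t. v m t - v n t) < e" if "max N1 N2 \<le> m" "max N1 N2 \<le> n" for m n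
  proof -
    have "(L2norm (\<lambda>t. v m t - v n t))\<^sup>2 \<le> 2 * c m + 2 * c n - 4 * d (max N1 N2)"
      using L2norm_parallelogram[OF v[of m] v[of n]] le[of m] le[of n] mid[OF that] by linarith
    also have "\<dots> < e\<^sup>2"
      using N1[of m] N1[of n] N2[of "max N1 N2"] that by linarith
    finally show ?thesis
      using \<open>0 < e\<close> by (simp add: power_less_imp_less_base)
  qed
  then show ?thesis by blast
qed

text \<open>Near-minimisers of the norm over the midpoint hulls of the tails converge strongly, by the
  parallelogram law. This replaces weak sequential compactness of balls together with Mazur's lemma.\<close>

lemma L2_bounded_midhull_limit:
  fixes u :: "nat \<Rightarrow> real \<Rightarrow> 'a::euclidean_space"
  assumes u: "\<And>n. u n \<in> L2" and b: "\<And>n. L2norm (u n) \<le> c"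
  obtains v w d where "\<And>n. v n \<in> midhull {u j |j. n \<le> j}" "w \<in> L2"
    "(\<lambda>n. L2norm (\<lambda>t. v n t - w t)) \<longlonglongrightarrow> 0" "L2norm w \<le> c"
    "d \<longlonglongrightarrow> (L2norm w)\<^sup>2" "\<And>n x. x \<in> midhull {u j |j. n \<le> j} \<Longrightarrow> d n \<le> (L2norm x)\<^sup>2"
proof -
  define K where "K n = midhull {u j |j. n \<le> j}" for n
  define d where "d n = (INF x\<in>K n. (L2norm x)\<^sup>2)" for n
  have K: "x \<in> L2" "L2norm x \<le> c" if "x \<in> K n" for x n
    using midhull_L2[of "{u j |j. n \<le> j}" c x] that u b by (auto simp: K_def)
  have uK: "u n \<in> K n" for n by (auto simp: K_def intro: midhull.base)
  have Kmono: "K n \<subseteq> K m" if "m \<le> n" for m n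
    unfolding K_def using that by (intro midhull_mono) auto
  have bdd: "bdd_below ((\<lambda>x. (L2norm x)\<^sup>2) ` K n)" for n by (rule bdd_belowI2[of _ 0]) simp
  have dle: "d n \<le> (L2norm x)\<^sup>2" if "x \<in> K n" for n x
    unfolding d_def by (rule cINF_lower[OF bdd that])
  have "incseq d"
    unfolding d_def using uK Kmono[OF le_SucI] bdd by (intro incseq_SucI cINF_superset_mono) fastforce+
  moreover have "d n \<le> c\<^sup>2" for n
    using dle[OF uK[of n]] b[of n] power_mono[of "L2norm (u n)" c 2] by simp
  ultimately obtain l where l: "d \<longlonglongrightarrow> l"
    using incseq_convergent[of d "c\<^sup>2"] by metis
  have "\<exists>x\<in>K n. (L2norm x)\<^sup>2 < d n + inverse (real (Suc n))" for n
  proof -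
    have "d n < d n + inverse (real (Suc n))" by simp
    then show ?thesis
      unfolding d_def by (subst (asm) (1) cINF_less_iff) (use uK bdd in auto)
  qed
  then obtain v where v: "\<And>n. v n \<in> K n" "\<And>n. (L2norm (v n))\<^sup>2 < d n + inverse (real (Suc n))"
    by metis
  have vL: "v n \<in> L2" for n using K v by blast
  have c: "(\<lambda>n. d n + inverse (real (Suc n))) \<longlonglongrightarrow> l"
    using tendsto_add[OF l LIMSEQ_inverse_real_of_nat] by simp
  have "\<exists>N. \<forall>m\<ge>N. \<forall>n\<ge>N. L2norm (\<lambda>t. v m t - v n t) < e" if "0 < e" for e
  proof (rule L2_Cauchy_if_norms[OF vL _ c l _ that])
    show "(L2norm (v n))\<^sup>2 \<le> d n + inverse (real (Suc n))" for n using v by (simp add: less_imp_le)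
    show "d j \<le> (L2norm (\<lambda>t. (1/2) *\<^sub>R (v m t + v n t)))\<^sup>2" if "j \<le> m" "j \<le> n" for j m n
    proof (rule dle)
      have "v m \<in> K j" "v n \<in> K j" using v Kmono that by blast+
      then show "(\<lambda>t. (1/2) *\<^sub>R (v m t + v n t)) \<in> K j" unfolding K_def by (rule midhull.mid)
    qed
  qed
  then obtain w where w: "w \<in> L2" "(\<lambda>n. L2norm (\<lambda>t. v n t - w t)) \<longlonglongrightarrow> 0"
    using L2_complete[of v] vL by blast
  have n: "(\<lambda>n. L2norm (v n)) \<longlonglongrightarrow> L2norm w" by (rule tendsto_L2norm[OF vL w])
  have "(\<lambda>n. (L2norm (v n))\<^sup>2) \<longlonglongrightarrow> l"
    by (rule tendsto_sandwich[OF _ _ l c])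
       (use v dle in \<open>auto intro!: always_eventually less_imp_le\<close>)
  with tendsto_power[OF n] have "(L2norm w)\<^sup>2 = l" by (rule LIMSEQ_unique)
  moreover have "L2norm w \<le> c"
    by (rule LIMSEQ_le_const2[OF n]) (use K v in blast)
  ultimately show ?thesis using that[of v w d] v w l dle by (simp add: K_def)
qed

lemma Uball_strong_limit:
  assumes v: "\<And>n. v n \<in> Uball \<rho>" and w: "w \<in> L2" and "(\<lambda>n. L2norm (\<lambda>t. v n t - w t)) \<longlonglongrightarrow> 0"
  shows "w \<in> Uball \<rho>"
proof -
  have "(\<lambda>n. L2norm (v n)) \<longlonglongrightarrow> L2norm w"
    using assms by (intro tendsto_L2norm) (auto simp: Uball_def)
  then have "L2norm w \<le> \<rho>"
    by (rule LIMSEQ_le_const2) (use v in \<open>auto simp: Uball_def\<close>)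
  with w show ?thesis by (simp add: Uball_def)
qed

section \<open>Trajectories of the control system\<close>

lemma norm_matrix_vector_mult_le:
  fixes A :: "real^'k^'n"
  shows "norm (A *v x) \<le> norm A * norm x"
proof -
  have "norm (A *v x) = L2_set (\<lambda>i. norm (A $ i \<bullet> x)) UNIV"
    by (simp add: norm_vec_def matrix_vector_mul_component)
  also have "\<dots> \<le> L2_set (\<lambda>i. norm (A $ i) * norm x) UNIV"
    by (intro L2_set_mono) (auto simp: Cauchy_Schwarz_ineq2)
  also have "\<dots> = norm A * norm x"
    by (simp add: L2_set_left_distrib norm_vec_def[of A])
  finally show ?thesis .
qed

lemma absolutely_integrable_matrix_vector_mult:
  fixes G :: "real \<Rightarrow> real^'k^'n"
  assumes G: "continuous_on {0..1} G" and u: "u \<in> L2" and st: "0 \<le> s" "t \<le> 1"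
  shows "(\<lambda>r. G r *v u r) absolutely_integrable_on {s..t}"
proof (rule absolutely_integrable_bounded_measurable_product[where h = "(*v)"])
  have "continuous_on {s..t} G" using G st by (auto intro: continuous_on_subset)
  then show "G \<in> borel_measurable (lebesgue_on {s..t})" "bounded (G ` {s..t})"
    by (auto intro!: continuous_imp_measurable_on_sets_lebesgue compact_imp_bounded compact_continuous_image)
  show "bilinear ((*v) :: real^'k^'n \<Rightarrow> _)"
    by (auto simp: bilinear_def linear_iff algebra_simps scaleR_matrix_vector_assoc)
qed (use L2_absolutely_integrable u st in auto)

lemma integrable_continuous_mult_norm:
  fixes g :: "real \<Rightarrow> real"
  assumes g: "continuous_on {0..1} g" and u: "u \<in> L2" and st: "0 \<le> s" "t \<le> 1"
  shows "(\<lambda>r. g r * norm (u r)) integrable_on {s..t}"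
proof -
  have "continuous_on {s..t} g" using g st by (auto intro: continuous_on_subset)
  moreover have "(\<lambda>r. norm (u r)) absolutely_integrable_on {s..t}"
    using L2_absolutely_integrable[OF u st] by (simp add: absolutely_integrable_on_def)
  ultimately have "(\<lambda>r. g r * norm (u r)) absolutely_integrable_on {s..t}"
    by (intro absolutely_integrable_bounded_measurable_product_real)
       (auto intro!: continuous_imp_measurable_on_sets_lebesgue compact_imp_bounded compact_continuous_image)
  then show ?thesis by (simp add: absolutely_integrable_on_def)
qed

lemma norm_integral_matrix_vector_mult_le:
  fixes G :: "real \<Rightarrow> real^'k^'n"
  assumes G: "continuous_on {0..1} G" and g: "continuous_on {0..1} g" and u: "u \<in> L2"
    and st: "0 \<le> s" "t \<le> 1" and le: "\<And>r. s \<le> r \<Longrightarrow> r \<le> t \<Longrightarrow> norm (G r) \<le> g r"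
  shows "norm (integral {s..t} (\<lambda>r. G r *v u r)) \<le> integral {s..t} (\<lambda>r. g r * norm (u r))"
proof (rule integral_norm_bound_integral)
  show "(\<lambda>r. G r *v u r) integrable_on {s..t}"
    using absolutely_integrable_matrix_vector_mult[OF G u st] by (simp add: absolutely_integrable_on_def)
  show "(\<lambda>r. g r * norm (u r)) integrable_on {s..t}"
    by (rule integrable_continuous_mult_norm[OF g u st])
  show "norm (G r *v u r) \<le> g r * norm (u r)" if "r \<in> {s..t}" for r
    by (rule order_trans[OF norm_matrix_vector_mult_le mult_right_mono[OF le]]) (use that in auto)
qed

definition solves ::
  "real^'n \<Rightarrow> (real^'n \<Rightarrow> real^'k^'n) \<Rightarrow> (real \<Rightarrow> real^'k) \<Rightarrow> (real \<Rightarrow> real^'n) \<Rightarrow> bool" where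
  "solves x0 F u x \<longleftrightarrow> x 0 = x0 \<and>
      (\<forall>t\<in>{0..1}. ((\<lambda>s. F (x s) *v u s) has_integral (x t - x0)) {0..t})"

lemma solves_continuous:
  assumes "solves x0 F u x"
  shows "continuous_on {0..1} x"
proof -
  let ?f = "\<lambda>s. F (x s) *v u s"
  have "continuous_on {0..1} (\<lambda>t. x0 + integral {0..t} ?f)"
    using assms by (intro continuous_intros indefinite_integral_continuous_1) (auto simp: solves_def)
  then show ?thesis
    by (rule continuous_on_eq) (use assms in \<open>auto simp: solves_def dest!: bspec integral_unique\<close>)
qed

lemma solves_increment:
  assumes "solves x0 F u x" "0 \<le> s" "s \<le> t" "t \<le> 1"
  shows "x t - x s = integral {s..t} (\<lambda>s. F (x s) *v u s)"
proof -
  let ?f = "\<lambda>s. F (x s) *v u s"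
  have I: "(?f has_integral (x t - x0)) {0..t}" "(?f has_integral (x s - x0)) {0..s}"
    using assms by (auto simp: solves_def)
  then have "integral {0..s} ?f + integral {s..t} ?f = integral {0..t} ?f"
    using assms by (intro Henstock_Kurzweil_Integration.integral_combine) auto
  then show ?thesis using I[THEN integral_unique] by (simp add: algebra_simps)
qed

locale lipschitz_system =
  fixes x0 :: "real^'n" and F :: "real^'n \<Rightarrow> real^'k^'n" and L \<rho> :: real
  assumes lipschitz: "L-lipschitz_on UNIV F" and L_pos: "0 < L" and \<rho>_nonneg: "0 \<le> \<rho>"
begin

lemma continuous_F: "continuous_on S x \<Longrightarrow> continuous_on S (\<lambda>t. F (x t))"
  by (rule continuous_on_compose2[OF lipschitz_on_continuous_on[OF lipschitz]]) auto

lemma norm_F_diff: "norm (F x - F y) \<le> L * norm (x - y)"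
  using lipschitz_onD[OF lipschitz, of x y] by (simp add: dist_norm)

definition weight :: real where "weight = 2 * L\<^sup>2 * (\<rho>\<^sup>2 + 1)"

lemma weight_pos: "0 < weight"
  using L_pos by (simp add: weight_def add_nonneg_pos)

lemma weighted_norm_integral:
  assumes u: "u \<in> Uball \<rho>" and t: "0 \<le> t" "t \<le> 1"
  shows "integral {0..t} (\<lambda>s. exp (weight * s) * norm (u s)) \<le> exp (weight * t) / (2 * L)"
proof -
  define \<eta> where "\<eta> = 1 / (2 * L * (\<rho>\<^sup>2 + 1))"
  have R: "0 < \<rho>\<^sup>2 + 1" by (simp add: add_nonneg_pos)
  have \<eta>: "0 < \<eta>" using L_pos R by (simp add: \<eta>_def)
  have uL: "u \<in> L2" and un: "L2norm u \<le> \<rho>" using u by (auto simp: Uball_def)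
  have pt: "exp (weight * s) * norm (u s) \<le>
      exp (weight * t) * (exp (2 * weight * (s - t)) / (2 * \<eta>) + \<eta> / 2 * (norm (u s))\<^sup>2)" for s
  proof -
    let ?a = "exp (weight * (s - t))"
    have "0 \<le> (?a - \<eta> * norm (u s))\<^sup>2 / (2 * \<eta>)" using \<eta> by simp
    also have "\<dots> = ?a\<^sup>2 / (2 * \<eta>) + \<eta> / 2 * (norm (u s))\<^sup>2 - ?a * norm (u s)"
      using \<eta> by (simp add: field_simps power2_eq_square)
    finally have "?a * norm (u s) \<le> exp (2 * weight * (s - t)) / (2 * \<eta>) + \<eta> / 2 * (norm (u s))\<^sup>2"
      by (simp add: exp_double[symmetric] mult.assoc)
    then have "exp (weight * t) * (?a * norm (u s)) \<le>
        exp (weight * t) * (exp (2 * weight * (s - t)) / (2 * \<eta>) + \<eta> / 2 * (norm (u s))\<^sup>2)"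
      by (rule mult_left_mono) simp
    moreover have "exp (weight * t) * ?a = exp (weight * s)"
      by (simp add: exp_add[symmetric] algebra_simps)
    ultimately show ?thesis by (simp add: mult.assoc[symmetric])
  qed
  have "((\<lambda>s. exp (2 * weight * (s - t))) has_integral
      (exp (2 * weight * (t - t)) / (2 * weight) - exp (2 * weight * (0 - t)) / (2 * weight))) {0..t}"
    using t weight_pos
    by (intro fundamental_theorem_of_calculus)
       (auto intro!: derivative_eq_intros simp flip: has_real_derivative_iff_has_vector_derivative)
  moreover have "exp (2 * weight * (t - t)) / (2 * weight) - exp (2 * weight * (0 - t)) / (2 * weight) \<le> 1 / (2 * weight)"
    using weight_pos by simp
  ultimately obtain J where J: "((\<lambda>s. exp (2 * weight * (s - t))) has_integral J) {0..t}" "J \<le> 1 / (2 * weight)"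
    by blast
  have i0: "(\<lambda>t. (norm (u t))\<^sup>2) integrable_on {0..1}" using uL by (simp add: L2_iff)
  then have i: "(\<lambda>t. (norm (u t))\<^sup>2) integrable_on {0..t}"
    by (rule integrable_on_subinterval) (use t in auto)
  have Q: "integral {0..t} (\<lambda>t. (norm (u t))\<^sup>2) \<le> \<rho>\<^sup>2"
  proof -
    have "integral {0..t} (\<lambda>t. (norm (u t))\<^sup>2) \<le> (L2norm u)\<^sup>2"
      unfolding L2norm_sq[OF uL] using t i i0 by (intro integral_subset_le) auto
    also have "\<dots> \<le> \<rho>\<^sup>2" using un by (intro power_mono) auto
    finally show ?thesis .
  qed
  have hi: "((\<lambda>s. exp (weight * t) * (exp (2 * weight * (s - t)) / (2 * \<eta>) + \<eta> / 2 * (norm (u s))\<^sup>2))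
      has_integral exp (weight * t) * (J / (2 * \<eta>) + \<eta> / 2 * integral {0..t} (\<lambda>t. (norm (u t))\<^sup>2))) {0..t}"
    by (intro has_integral_mult_right has_integral_add has_integral_divide J(1) integrable_integral i)
  have "integral {0..t} (\<lambda>s. exp (weight * s) * norm (u s)) \<le>
      exp (weight * t) * (J / (2 * \<eta>) + \<eta> / 2 * integral {0..t} (\<lambda>t. (norm (u t))\<^sup>2))"
    by (rule has_integral_le[OF integrable_integral hi])
       (use pt t in \<open>auto intro!: integrable_continuous_mult_norm uL continuous_intros\<close>)
  also have "\<dots> \<le> exp (weight * t) * (1 / (2 * weight) / (2 * \<eta>) + \<eta> / 2 * \<rho>\<^sup>2)"
    using J(2) Q \<eta> by (intro mult_left_mono add_mono divide_right_mono) auto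
  also have "\<dots> \<le> exp (weight * t) * (1 / (2 * L))"
  proof (rule mult_left_mono)
    have "1 / (2 * weight) / (2 * \<eta>) = 1 / (4 * L)"
      using L_pos R by (simp add: weight_def \<eta>_def power2_eq_square)
    moreover have "\<eta> / 2 * \<rho>\<^sup>2 \<le> 1 / (4 * L)"
    proof -
      have "\<eta> / 2 * \<rho>\<^sup>2 = \<rho>\<^sup>2 / (\<rho>\<^sup>2 + 1) / (4 * L)" by (simp add: \<eta>_def)
      also have "\<dots> \<le> 1 / (4 * L)" using L_pos R by (intro divide_right_mono) auto
      finally show ?thesis .
    qed
    ultimately show "1 / (2 * weight) / (2 * \<eta>) + \<eta> / 2 * \<rho>\<^sup>2 \<le> 1 / (2 * L)"
      using L_pos by (simp add: field_simps)
  qed simp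
  finally show ?thesis by simp
qed

lemma weighted_Gronwall:
  assumes u: "u \<in> Uball \<rho>" and z: "continuous_on {0..1} z" and z0: "\<And>t. 0 \<le> z t" and c: "0 \<le> c"
    and le: "\<And>t. 0 \<le> t \<Longrightarrow> t \<le> 1 \<Longrightarrow> z t \<le> integral {0..t} (\<lambda>s. (c + L * z s) * norm (u s))"
    and t: "0 \<le> t" "t \<le> 1"
  shows "z t \<le> exp (weight * t) * (c / L)"
proof -
  have uL: "u \<in> L2" using u by (auto simp: Uball_def)
  have "continuous_on {0..1} (\<lambda>s. exp (- weight * s) * z s)"
    using z by (intro continuous_intros)
  then obtain T where T: "T \<in> {0..1}"
    and max: "\<And>s. s \<in> {0..1} \<Longrightarrow> exp (- weight * s) * z s \<le> exp (- weight * T) * z T"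
    using continuous_attains_sup[of "{0..1}" "\<lambda>s. exp (- weight * s) * z s"] by auto
  define M where "M = exp (- weight * T) * z T"
  have M0: "0 \<le> M" using z0 by (simp add: M_def)
  have zM: "z s \<le> exp (weight * s) * M" if "s \<in> {0..1}" for s
    using mult_left_mono[OF max[OF that], of "exp (weight * s)"]
    by (simp add: M_def mult.assoc[symmetric] exp_add[symmetric])
  have "z T \<le> integral {0..T} (\<lambda>s. (c + L * z s) * norm (u s))"
    using le T by simp
  also have "\<dots> \<le> integral {0..T} (\<lambda>s. (c + L * M) * (exp (weight * s) * norm (u s)))"
  proof (rule integral_le)
    show "(\<lambda>s. (c + L * z s) * norm (u s)) integrable_on {0..T}"
      using T z by (intro integrable_continuous_mult_norm uL continuous_intros) auto
    show "(\<lambda>s. (c + L * M) * (exp (weight * s) * norm (u s))) integrable_on {0..T}"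
      using T by (intro integrable_on_mult_right integrable_continuous_mult_norm uL continuous_intros) auto
    show "(c + L * z s) * norm (u s) \<le> (c + L * M) * (exp (weight * s) * norm (u s))" if "s \<in> {0..T}" for s
    proof -
      have "c * 1 \<le> c * exp (weight * s)"
        using c weight_pos that by (intro mult_left_mono) auto
      moreover have "L * z s \<le> L * (exp (weight * s) * M)"
        using zM[of s] T that L_pos by (intro mult_left_mono) auto
      ultimately have "c + L * z s \<le> (c + L * M) * exp (weight * s)"
        by (simp add: algebra_simps)
      then show ?thesis
        unfolding mult.assoc[symmetric] by (rule mult_right_mono) simp
    qed
  qed
  also have "\<dots> = (c + L * M) * integral {0..T} (\<lambda>s. exp (weight * s) * norm (u s))"
    by simp
  also have "\<dots> \<le> (c + L * M) * (exp (weight * T) / (2 * L))"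
    using weighted_norm_integral[OF u, of T] T c M0 L_pos by (intro mult_left_mono) auto
  finally have "M \<le> exp (- weight * T) * ((c + L * M) * (exp (weight * T) / (2 * L)))"
    unfolding M_def by (rule mult_left_mono) simp
  also have "\<dots> = (exp (- weight * T) * exp (weight * T)) * ((c + L * M) / (2 * L))"
    by simp
  also have "\<dots> = (c + L * M) / (2 * L)"
    by (simp add: mult_exp_exp)
  finally have "M \<le> c / L" using L_pos by (simp add: field_simps)
  then have "exp (weight * t) * M \<le> exp (weight * t) * (c / L)" by (rule mult_left_mono) simp
  then show ?thesis using zM[of t] t by simp
qed

lemma solves_unique:
  assumes u: "u \<in> Uball \<rho>" and x: "solves x0 F u x" and y: "solves x0 F u y" and t: "0 \<le> t" "t \<le> 1"
  shows "x t = y t"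
proof -
  have uL: "u \<in> L2" using u by (auto simp: Uball_def)
  note cx = solves_continuous[OF x] and cy = solves_continuous[OF y]
  have "norm (x t - y t) \<le> exp (weight * t) * (0 / L)"
  proof (rule weighted_Gronwall[OF u _ _ _ _ t])
    show "continuous_on {0..1} (\<lambda>t. norm (x t - y t))"
      using cx cy by (intro continuous_intros)
    fix t :: real assume t: "0 \<le> t" "t \<le> 1"
    have "((\<lambda>s. F (x s) *v u s - F (y s) *v u s) has_integral ((x t - x0) - (y t - x0))) {0..t}"
      using x y t by (intro has_integral_diff) (auto simp: solves_def)
    then have "integral {0..t} (\<lambda>s. (F (x s) - F (y s)) *v u s) = x t - y t"
      by (simp add: integral_unique matrix_vector_mult_diff_rdistrib)
    then have "norm (x t - y t) = norm (integral {0..t} (\<lambda>s. (F (x s) - F (y s)) *v u s))"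
      by simp
    also have "\<dots> \<le> integral {0..t} (\<lambda>s. (0 + L * norm (x s - y s)) * norm (u s))"
      using t cx cy norm_F_diff
      by (intro norm_integral_matrix_vector_mult_le uL continuous_intros continuous_F) auto
    finally show "norm (x t - y t) \<le> integral {0..t} (\<lambda>s. (0 + L * norm (x s - y s)) * norm (u s))" .
  qed auto
  then show ?thesis by simp
qed

definition radius :: real where "radius = exp weight * (norm (F x0) / L)"

lemma solves_bounded:
  assumes u: "u \<in> Uball \<rho>" and x: "solves x0 F u x" and t: "0 \<le> t" "t \<le> 1"
  shows "norm (x t - x0) \<le> radius"
proof -
  have uL: "u \<in> L2" using u by (auto simp: Uball_def)
  note cx = solves_continuous[OF x]
  have "norm (x t - x0) \<le> exp (weight * t) * (norm (F x0) / L)"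
  proof (rule weighted_Gronwall[OF u _ _ _ _ t])
    show "continuous_on {0..1} (\<lambda>t. norm (x t - x0))"
      using cx by (intro continuous_intros)
    fix t :: real assume t: "0 \<le> t" "t \<le> 1"
    have F: "norm (F (x s)) \<le> norm (F x0) + L * norm (x s - x0)" for s
      using norm_F_diff[of "x s" x0] norm_triangle_sub[of "F (x s)" "F x0"] by linarith
    have "norm (x t - x0) = norm (integral {0..t} (\<lambda>s. F (x s) *v u s))"
      using x t by (auto simp: solves_def dest!: bspec integral_unique)
    also have "\<dots> \<le> integral {0..t} (\<lambda>s. (norm (F x0) + L * norm (x s - x0)) * norm (u s))"
      using t cx F
      by (intro norm_integral_matrix_vector_mult_le uL continuous_intros continuous_F) auto
    finally show "norm (x t - x0) \<le> integral {0..t} (\<lambda>s. (norm (F x0) + L * norm (x s - x0)) * norm (u s))" .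
  qed auto
  also have "\<dots> \<le> radius"
    unfolding radius_def using weight_pos t L_pos
    by (intro mult_right_mono) (auto simp: mult_le_cancel_left1)
  finally show ?thesis .
qed

text \<open>In the weighted unknown exp (- weight * t) x(t) the Picard operator contracts by the factor 1/2.\<close>

lemma solves_exists:
  assumes u: "u \<in> Uball \<rho>"
  obtains x where "solves x0 F u x"
proof -
  have uL: "u \<in> L2" using u by (auto simp: Uball_def)
  define cl :: "real \<Rightarrow> real" where "cl t = max 0 (min 1 t)" for t
  have cl: "cl t \<in> {0..1}" "0 \<le> cl t" "cl t \<le> 1" for t by (auto simp: cl_def)
  define G where "G y s = F (exp (weight * s) *\<^sub>R apply_bcontfun y s)" for y s
  define P where "P y t = exp (- weight * t) *\<^sub>R (x0 + integral {0..t} (\<lambda>s. G y s *v u s))" for y t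
  have cG: "continuous_on {0..1} (G y)" for y
    unfolding G_def by (intro continuous_F continuous_intros continuous_on_apply_bcontfun)
  have iG: "(\<lambda>s. G y s *v u s) integrable_on {0..t}" if "t \<le> 1" for y t
    using absolutely_integrable_matrix_vector_mult[OF cG uL _ that] by (simp add: absolutely_integrable_on_def)
  have cP: "continuous_on {0..1} (P y)" for y
    unfolding P_def by (intro continuous_intros indefinite_integral_continuous_1 iG) simp
  have "(\<lambda>t. P y (cl t)) \<in> bcontfun" for y
  proof -
    have "continuous_on UNIV (\<lambda>t. P y (cl t))"
      by (rule continuous_on_compose2[OF cP]) (use cl in \<open>auto simp: cl_def intro!: continuous_intros\<close>)
    moreover have "range (\<lambda>t. P y (cl t)) \<subseteq> P y ` {0..1}" using cl by auto
    moreover have "bounded (P y ` {0..1})"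
      by (intro compact_imp_bounded compact_continuous_image cP) simp
    ultimately show ?thesis unfolding bcontfun_def using bounded_subset by blast
  qed
  then have T: "apply_bcontfun (Bcontfun (\<lambda>t. P y (cl t))) t = P y (cl t)" for y t
    by (simp add: Bcontfun_inverse)
  have P: "dist (P y t) (P z t) \<le> 1/2 * dist y z" if t: "0 \<le> t" "t \<le> 1" for y z t
  proof -
    let ?D = "integral {0..t} (\<lambda>s. (G y s - G z s) *v u s)"
    have GG: "norm (G y s - G z s) \<le> L * (exp (weight * s) * dist y z)" for s
    proof -
      have "norm (G y s - G z s) \<le> L * norm (exp (weight * s) *\<^sub>R (apply_bcontfun y s - apply_bcontfun z s))"
        unfolding G_def scaleR_diff_right by (rule norm_F_diff)
      also have "\<dots> \<le> L * (exp (weight * s) * dist y z)"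
        using dist_bounded[of y s z] L_pos by (simp add: dist_norm)
      finally show ?thesis .
    qed
    have "P y t - P z t = exp (- weight * t) *\<^sub>R ?D"
      unfolding P_def
      using Henstock_Kurzweil_Integration.integral_diff[OF iG[OF t(2)] iG[OF t(2)], of y z]
      by (simp add: matrix_vector_mult_diff_rdistrib scaleR_diff_right[symmetric])
    then have "dist (P y t) (P z t) = exp (- weight * t) * norm ?D" by (simp add: dist_norm)
    also have "\<dots> \<le> exp (- weight * t) * integral {0..t} (\<lambda>s. L * (exp (weight * s) * dist y z) * norm (u s))"
      using t GG
      by (intro mult_left_mono norm_integral_matrix_vector_mult_le uL continuous_intros cG) auto
    also have "(\<lambda>s. L * (exp (weight * s) * dist y z) * norm (u s)) =
        (\<lambda>s. (L * dist y z) * (exp (weight * s) * norm (u s)))" by (auto simp: algebra_simps)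
    also have "integral {0..t} \<dots> = (L * dist y z) * integral {0..t} (\<lambda>s. exp (weight * s) * norm (u s))"
      by simp
    also have "exp (- weight * t) * \<dots> \<le> exp (- weight * t) * ((L * dist y z) * (exp (weight * t) / (2 * L)))"
      using weighted_norm_integral[OF u t] L_pos by (intro mult_left_mono) auto
    also have "\<dots> = 1/2 * dist y z"
      using L_pos by (simp add: exp_minus field_simps)
    finally show ?thesis .
  qed
  have "\<exists>!y. Bcontfun (\<lambda>t. P y (cl t)) = y"
  proof (rule banach_fix_type[of "1/2"])
    show "\<forall>y z. dist (Bcontfun (\<lambda>t. P y (cl t))) (Bcontfun (\<lambda>t. P z (cl t))) \<le> 1/2 * dist y z"
      by (intro allI dist_bound) (simp only: T P[OF cl(2,3)])
  qed auto
  then obtain y where y: "Bcontfun (\<lambda>t. P y (cl t)) = y" by blast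
  define x where "x t = exp (weight * t) *\<^sub>R apply_bcontfun y t" for t
  have "x t = x0 + integral {0..t} (\<lambda>s. F (x s) *v u s)" if t: "0 \<le> t" "t \<le> 1" for t
  proof -
    have "apply_bcontfun y t = P y t" using T[of y t] y t by (simp add: cl_def)
    then have "x t = x0 + integral {0..t} (\<lambda>s. G y s *v u s)"
      by (simp add: x_def P_def exp_minus)
    then show ?thesis by (simp add: G_def x_def)
  qed
  moreover have "((\<lambda>s. F (x s) *v u s) has_integral integral {0..t} (\<lambda>s. F (x s) *v u s)) {0..t}" if "t \<le> 1" for t
    using iG[OF that, of y] by (simp add: integrable_integral G_def x_def)
  ultimately have "solves x0 F u x" by (simp add: solves_def)
  then show ?thesis by (rule that)
qed

lemma endpoint_eq:
  assumes u: "u \<in> Uball \<rho>" and x: "solves x0 F u x"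
  shows "endpoint x0 F u = x 1"
  unfolding endpoint_def
proof (rule the_equality)
  show "\<exists>z. z 0 = x0 \<and> (\<forall>t\<in>{0..1}. ((\<lambda>s. F (z s) *v u s) has_integral (z t - x0)) {0..t}) \<and> x 1 = z 1"
    using x unfolding solves_def by blast
  fix y assume "\<exists>z. z 0 = x0 \<and> (\<forall>t\<in>{0..1}. ((\<lambda>s. F (z s) *v u s) has_integral (z t - x0)) {0..t}) \<and> y = z 1"
  then obtain z where "solves x0 F u z" "y = z 1" unfolding solves_def by blast
  then show "y = x 1" using solves_unique[OF u _ x, of z 1] by simp
qed

lemma solves_equicontinuous:
  assumes "0 < e"
  obtains d where "0 < d" "\<And>u x s t. u \<in> Uball \<rho> \<Longrightarrow> solves x0 F u x \<Longrightarrow> s \<in> {0..1} \<Longrightarrow> t \<in> {0..1} \<Longrightarrow>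
    \<bar>s - t\<bar> < d \<Longrightarrow> norm (x s - x t) < e"
proof -
  define B where "B = norm (F x0) + L * radius + 1"
  have "0 \<le> radius" using L_pos by (simp add: radius_def)
  then have B: "0 < B" using L_pos by (simp add: B_def add_nonneg_pos)
  define \<eta> where "\<eta> = e / (B * (\<rho>\<^sup>2 + 1))"
  have R: "0 < \<rho>\<^sup>2 + 1" by (simp add: add_nonneg_pos)
  have \<eta>: "0 < \<eta>" using \<open>0 < e\<close> B R by (simp add: \<eta>_def)
  define d where "d = \<eta> * e / B"
  have d: "0 < d" using \<eta> \<open>0 < e\<close> B by (simp add: d_def)
  have main: "norm (x t - x s) < e"
    if u: "u \<in> Uball \<rho>" and x: "solves x0 F u x" and st: "0 \<le> s" "s \<le> t" "t \<le> 1" "t - s < d" for u x s t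
  proof -
    have uL: "u \<in> L2" and un: "L2norm u \<le> \<rho>" using u by (auto simp: Uball_def)
    note cx = solves_continuous[OF x]
    have FB: "norm (F (x r)) \<le> B" if "0 \<le> r" "r \<le> 1" for r
      using norm_F_diff[of "x r" x0] norm_triangle_sub[of "F (x r)" "F x0"]
        mult_left_mono[OF solves_bounded[OF u x that], of L] L_pos unfolding B_def by linarith
    have "norm (x t - x s) = norm (integral {s..t} (\<lambda>r. F (x r) *v u r))"
      using solves_increment[OF x st(1-3)] by simp
    also have "\<dots> \<le> integral {s..t} (\<lambda>r. B * norm (u r))"
      using st cx FB by (intro norm_integral_matrix_vector_mult_le uL continuous_intros continuous_F) auto
    also have "\<dots> = B * integral {s..t} (\<lambda>r. norm (u r))" by simp
    also have "\<dots> \<le> B * ((t - s) / (2 * \<eta>) + \<eta> / 2 * (L2norm u)\<^sup>2)"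
      using B by (intro mult_left_mono integral_norm_le uL st \<eta>) auto
    also have "\<dots> < B * (d / (2 * \<eta>) + \<eta> / 2 * (\<rho>\<^sup>2 + 1))"
    proof (intro mult_strict_left_mono add_less_le_mono divide_strict_right_mono mult_left_mono B)
      show "(L2norm u)\<^sup>2 \<le> \<rho>\<^sup>2 + 1" using power_mono[OF un, of 2] by simp
    qed (use st \<eta> in auto)
    also have "\<dots> = e"
    proof -
      have "B * (d / (2 * \<eta>)) = e / 2" using B \<eta> by (simp add: d_def)
      moreover have "B * (\<eta> / 2 * (\<rho>\<^sup>2 + 1)) = e / 2" using B R by (simp add: \<eta>_def)
      ultimately show ?thesis by (simp add: distrib_left)
    qed
    finally show ?thesis .
  qed
  show ?thesis
  proof (rule that[OF d])
    fix u x s t assume *: "u \<in> Uball \<rho>" "solves x0 F u x" "s \<in> {0..1}" "t \<in> {0..1}" "\<bar>s - t\<bar> < d"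
    show "norm (x s - x t) < e"
    proof (cases "s \<le> t")
      case True
      then show ?thesis using main[OF *(1,2), of s t] * by (simp add: norm_minus_commute)
    next
      case False
      then show ?thesis using main[OF *(1,2), of t s] * by simp
    qed
  qed
qed

lemma trajectory_subseq:
  assumes u: "\<And>j. u j \<in> Uball \<rho>"
  obtains r x where "strict_mono (r :: nat \<Rightarrow> nat)" "continuous_on {0..1} x"
    "(\<lambda>j. endpoint x0 F (u (r j))) \<longlonglongrightarrow> x 1"
    "\<And>t. t \<in> {0..1} \<Longrightarrow> (\<lambda>j. integral {0..t} (\<lambda>s. F (x s) *v u (r j) s)) \<longlonglongrightarrow> x t - x0"
proof -
  have uL: "u j \<in> L2" and un: "L2norm (u j) \<le> \<rho>" for j using u[of j] by (auto simp: Uball_def)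
  have "\<exists>y. solves x0 F (u j) y" for j using solves_exists[OF u[of j]] by blast
  then obtain y where y: "\<And>j. solves x0 F (u j) (y j)" by metis
  note cy = solves_continuous[OF y]
  obtain x r where x: "continuous_on {0..1} x" and r: "strict_mono (r :: nat \<Rightarrow> nat)"
    and lim: "\<And>e. 0 < e \<Longrightarrow> \<exists>N. \<forall>j t. N \<le> j \<and> t \<in> {0..1} \<longrightarrow> norm (y (r j) t - x t) < e"
  proof (rule Arzela_Ascoli[of "{0..1}" y "norm x0 + radius"])
    show "norm (y j t) \<le> norm x0 + radius" if "t \<in> {0..1}" for j t
      using solves_bounded[OF u y, of t j] norm_triangle_sub[of "y j t" x0] that by auto
    show "\<exists>d>0. \<forall>j s. s \<in> {0..1} \<and> norm (t - s) < d \<longrightarrow> norm (y j t - y j s) < e"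
      if t: "t \<in> {0..1}" and e: "0 < e" for t e
    proof -
      show ?thesis
        using solves_equicontinuous[OF e] u y t unfolding real_norm_def by metis
    qed
  qed (auto intro: that)
  have pointwise: "(\<lambda>j. y (r j) t) \<longlonglongrightarrow> x t" if "t \<in> {0..1}" for t
    unfolding LIMSEQ_iff using lim that by meson
  have "(\<lambda>j. integral {0..t} (\<lambda>s. F (x s) *v u (r j) s)) \<longlonglongrightarrow> x t - x0" if t: "t \<in> {0..1}" for t
  proof -
    let ?I = "\<lambda>G j. integral {0..t} (\<lambda>s. G s *v u (r j) s)"
    have "(\<lambda>j. ?I (\<lambda>s. F (y (r j) s) - F (x s)) j) \<longlonglongrightarrow> 0"
    proof (rule LIMSEQ_I)
      fix e :: real assume "0 < e"
      define e' where "e' = e / (L * (\<rho> + 1))"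
      have e': "0 < e'" using \<open>0 < e\<close> L_pos \<rho>_nonneg by (simp add: e'_def)
      then obtain N where N: "\<And>j s. N \<le> j \<Longrightarrow> s \<in> {0..1} \<Longrightarrow> norm (y (r j) s - x s) < e'"
        using lim by blast
      have "norm (?I (\<lambda>s. F (y (r j) s) - F (x s)) j) < e" if j: "N \<le> j" for j
      proof -
        have "norm (F (y (r j) s) - F (x s)) \<le> L * e'" if "s \<in> {0..1}" for s
          using norm_F_diff[of "y (r j) s" "x s"] mult_left_mono[OF less_imp_le[OF N[OF j that]], of L] L_pos
          by linarith
        then have "norm (?I (\<lambda>s. F (y (r j) s) - F (x s)) j) \<le> integral {0..t} (\<lambda>s. L * e' * norm (u (r j) s))"
          using t by (intro norm_integral_matrix_vector_mult_le uL continuous_intros continuous_F cy x) auto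
        also have "\<dots> = L * e' * integral {0..t} (\<lambda>s. norm (u (r j) s))" by simp
        also have "\<dots> \<le> L * e' * \<rho>"
          using integral_norm_le_L2norm[OF uL, of 0 t "r j"] un[of "r j"] t L_pos e'
          by (intro mult_left_mono) auto
        also have "\<dots> < L * e' * (\<rho> + 1)" using L_pos e' by (intro mult_strict_left_mono) auto
        also have "\<dots> = e" using L_pos \<rho>_nonneg by (simp add: e'_def)
        finally show ?thesis .
      qed
      then show "\<exists>N. \<forall>j\<ge>N. norm (?I (\<lambda>s. F (y (r j) s) - F (x s)) j - 0) < e" by auto
    qed
    moreover have "?I (\<lambda>s. F (y (r j) s) - F (x s)) j = (y (r j) t - x0) - ?I (\<lambda>s. F (x s)) j" for j
    proof -
      have "((\<lambda>s. F (x s) *v u (r j) s) has_integral ?I (\<lambda>s. F (x s)) j) {0..t}"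
        using absolutely_integrable_matrix_vector_mult[OF continuous_F[OF x] uL, of 0 t "r j"] t
        by (simp add: absolutely_integrable_on_def integrable_integral)
      moreover have "((\<lambda>s. F (y (r j) s) *v u (r j) s) has_integral (y (r j) t - x0)) {0..t}"
        using y[of "r j"] t by (simp add: solves_def)
      ultimately show ?thesis
        using integral_unique[OF has_integral_diff] by (simp add: matrix_vector_mult_diff_rdistrib)
    qed
    ultimately have "(\<lambda>j. (y (r j) t - x0) - ?I (\<lambda>s. F (x s)) j) \<longlonglongrightarrow> 0" by simp
    with tendsto_diff[OF pointwise[OF t] tendsto_const[of x0]]
    have "(\<lambda>j. (y (r j) t - x0) - ((y (r j) t - x0) - ?I (\<lambda>s. F (x s)) j)) \<longlonglongrightarrow> (x t - x0) - 0"
      by (rule tendsto_diff)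
    then show ?thesis by simp
  qed
  moreover have "(\<lambda>j. endpoint x0 F (u (r j))) \<longlonglongrightarrow> x 1"
    using pointwise[of 1] endpoint_eq[OF u y] by simp
  ultimately show ?thesis using that r x by blast
qed

lemma solves_strong_limit:
  assumes x: "continuous_on {0..1} x" and v: "\<And>n. v n \<in> L2" and w: "w \<in> L2"
    and vw: "(\<lambda>n. L2norm (\<lambda>t. v n t - w t)) \<longlonglongrightarrow> 0"
    and lim: "\<And>t. t \<in> {0..1} \<Longrightarrow> (\<lambda>n. integral {0..t} (\<lambda>s. F (x s) *v v n s)) \<longlonglongrightarrow> x t - x0"
  shows "solves x0 F w x"
proof -
  have "bounded ((\<lambda>s. F (x s)) ` {0..1})"
    by (intro compact_imp_bounded compact_continuous_image continuous_F x) simp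
  then obtain B where B: "0 < B" "\<And>s. s \<in> {0..1} \<Longrightarrow> norm (F (x s)) \<le> B"
    unfolding bounded_pos by auto
  have i: "(\<lambda>s. F (x s) *v z s) integrable_on {0..t}" if "z \<in> L2" "t \<in> {0..1}" for z t
    using absolutely_integrable_matrix_vector_mult[OF continuous_F[OF x], of z 0 t] that
    by (simp add: absolutely_integrable_on_def)
  have *: "integral {0..t} (\<lambda>s. F (x s) *v w s) = x t - x0" if t: "t \<in> {0..1}" for t
  proof -
    let ?I = "\<lambda>z. integral {0..t} (\<lambda>s. F (x s) *v z s)"
    have le: "norm (?I (v n) - ?I w) \<le> B * L2norm (\<lambda>t. v n t - w t)" for n
    proof -
      have dL: "(\<lambda>s. v n s - w s) \<in> L2" by (intro L2_diff v w)
      have "?I (v n) - ?I w = ?I (\<lambda>s. v n s - w s)"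
        using Henstock_Kurzweil_Integration.integral_diff[OF i[OF v t] i[OF w t], of n]
        by (simp add: matrix_vector_mult_diff_distrib)
      then have "norm (?I (v n) - ?I w) \<le> integral {0..t} (\<lambda>s. B * norm (v n s - w s))"
        using norm_integral_matrix_vector_mult_le[OF continuous_F[OF x] _ dL, of "\<lambda>_. B" 0 t] B t by simp
      also have "\<dots> = B * integral {0..t} (\<lambda>s. norm (v n s - w s))" by simp
      also have "\<dots> \<le> B * L2norm (\<lambda>t. v n t - w t)"
        using integral_norm_le_L2norm[OF dL, of 0 t] B t by (intro mult_left_mono) auto
      finally show ?thesis .
    qed
    have "(\<lambda>n. ?I (v n) - ?I w) \<longlonglongrightarrow> 0"
      by (rule Lim_null_comparison[OF _ tendsto_mult_right_zero[OF vw, of B]])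
         (intro always_eventually allI le)
    then have "(\<lambda>n. ?I (v n)) \<longlonglongrightarrow> ?I w" by (simp add: LIM_zero_iff)
    then show ?thesis using lim[OF t] by (rule LIMSEQ_unique)
  qed
  then have "((\<lambda>s. F (x s) *v w s) has_integral (x t - x0)) {0..t}" if "t \<in> {0..1}" for t
    using integrable_integral[OF i[OF w that]] that by simp
  moreover have "x 0 = x0" using *[of 0] by simp
  ultimately show ?thesis by (simp add: solves_def)
qed

lemma endpoint_strong_limit:
  assumes v: "\<And>n. v n \<in> Uball \<rho>" and w: "w \<in> L2"
    and vw: "(\<lambda>n. L2norm (\<lambda>t. v n t - w t)) \<longlonglongrightarrow> 0"
  obtains r where "strict_mono (r :: nat \<Rightarrow> nat)" "(\<lambda>j. endpoint x0 F (v (r j))) \<longlonglongrightarrow> endpoint x0 F w"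
proof -
  obtain r x where r: "strict_mono (r :: nat \<Rightarrow> nat)" and x: "continuous_on {0..1} x"
    and e: "(\<lambda>j. endpoint x0 F (v (r j))) \<longlonglongrightarrow> x 1"
    and lim: "\<And>t. t \<in> {0..1} \<Longrightarrow> (\<lambda>j. integral {0..t} (\<lambda>s. F (x s) *v v (r j) s)) \<longlonglongrightarrow> x t - x0"
    using trajectory_subseq[of v] v by blast
  have "solves x0 F w x"
  proof (rule solves_strong_limit[OF x _ w _ lim])
    show "v (r j) \<in> L2" for j using v by (auto simp: Uball_def)
    show "(\<lambda>j. L2norm (\<lambda>t. v (r j) t - w t)) \<longlonglongrightarrow> 0"
      using LIMSEQ_subseq_LIMSEQ[OF vw r] by (simp add: o_def)
  qed
  then show ?thesis
    using that r e endpoint_eq[OF Uball_strong_limit[OF v w vw]] by metis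
qed

text \<open>The integral equation passes to the strong limit of hull elements because closed balls are
  stable under midpoints.\<close>

lemma control_compactness:
  assumes u: "\<And>j. u j \<in> Uball \<rho>"
  obtains r w d where "strict_mono (r :: nat \<Rightarrow> nat)" "w \<in> Uball \<rho>"
    "(\<lambda>j. endpoint x0 F (u (r j))) \<longlonglongrightarrow> endpoint x0 F w"
    "d \<longlonglongrightarrow> (L2norm w)\<^sup>2" "\<And>n. d n \<le> (L2norm (u (r n)))\<^sup>2"
    "\<And>j m n. j \<le> m \<Longrightarrow> j \<le> n \<Longrightarrow> d j \<le> (L2norm (\<lambda>t. (1/2) *\<^sub>R (u (r m) t + u (r n) t)))\<^sup>2"
proof -
  obtain r x where r: "strict_mono (r :: nat \<Rightarrow> nat)" and x: "continuous_on {0..1} x"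
    and e: "(\<lambda>j. endpoint x0 F (u (r j))) \<longlonglongrightarrow> x 1"
    and lim: "\<And>t. t \<in> {0..1} \<Longrightarrow> (\<lambda>j. integral {0..t} (\<lambda>s. F (x s) *v u (r j) s)) \<longlonglongrightarrow> x t - x0"
    using trajectory_subseq[of u] u by blast
  have uL: "u (r j) \<in> L2" "L2norm (u (r j)) \<le> \<rho>" for j using u[of "r j"] by (auto simp: Uball_def)
  obtain v w d where v: "\<And>n. v n \<in> midhull {u (r j) |j. n \<le> j}" and w: "w \<in> L2"
    and vw: "(\<lambda>n. L2norm (\<lambda>t. v n t - w t)) \<longlonglongrightarrow> 0" and w\<rho>: "L2norm w \<le> \<rho>"
    and d: "d \<longlonglongrightarrow> (L2norm w)\<^sup>2"
    and dle: "\<And>n y. y \<in> midhull {u (r j) |j. n \<le> j} \<Longrightarrow> d n \<le> (L2norm y)\<^sup>2"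
    using L2_bounded_midhull_limit[of "\<lambda>j. u (r j)" \<rho>] uL by blast
  have vL: "v n \<in> L2" for n
    using midhull_L2[of "{u (r j) |j. n \<le> j}" \<rho> "v n"] uL v by blast
  have "solves x0 F w x"
  proof (rule solves_strong_limit[OF x vL w vw])
    fix t :: real assume t: "t \<in> {0..1}"
    let ?I = "\<lambda>z. integral {0..t} (\<lambda>s. F (x s) *v z s)"
    have i: "(\<lambda>s. F (x s) *v z s) integrable_on {0..t}" if "z \<in> L2" for z
      using absolutely_integrable_matrix_vector_mult[OF continuous_F[OF x], of z 0 t] that t
      by (simp add: absolutely_integrable_on_def)
    have hull: "z \<in> L2 \<and> ?I z \<in> cball c e"
      if S: "\<And>z. z \<in> S \<Longrightarrow> z \<in> L2 \<and> ?I z \<in> cball c e" and "z \<in> midhull S" for z S c e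
      using that(2)
    proof induction
      case (mid y z)
      have "?I (\<lambda>t. (1/2) *\<^sub>R (y t + z t)) = (1/2) *\<^sub>R integral {0..t} (\<lambda>s. F (x s) *v y s + F (x s) *v z s)"
        unfolding matrix_vector_mult_scaleR matrix_vector_right_distrib by (rule integral_cmul)
      also have "\<dots> = (1/2) *\<^sub>R ?I y + (1/2) *\<^sub>R ?I z"
        using mid.IH Henstock_Kurzweil_Integration.integral_add[OF i i, of y z] by (simp add: scaleR_add_right)
      finally have "?I (\<lambda>t. (1/2) *\<^sub>R (y t + z t)) = (1/2) *\<^sub>R ?I y + (1/2) *\<^sub>R ?I z" .
      moreover have "(1/2) *\<^sub>R ?I y + (1/2) *\<^sub>R ?I z \<in> cball c e"
        using mid.IH by (intro convexD[OF convex_cball]) auto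
      ultimately show ?case using mid.IH by (auto intro: L2_scaleR L2_add)
    qed (use S in auto)
    show "(\<lambda>n. ?I (v n)) \<longlonglongrightarrow> x t - x0"
    proof (rule LIMSEQ_I)
      fix e :: real assume "0 < e"
      then obtain N where N: "\<And>j. N \<le> j \<Longrightarrow> norm (?I (u (r j)) - (x t - x0)) < e / 2"
        using LIMSEQ_D[OF lim[OF t], of "e / 2"] by auto
      have "norm (?I (v n) - (x t - x0)) < e" if "N \<le> n" for n
      proof -
        have "?I (v n) \<in> cball (x t - x0) (e / 2)"
        proof (rule conjunct2[OF hull[OF _ v[of n]]])
          fix z assume "z \<in> {u (r j) |j. n \<le> j}"
          then obtain j where "z = u (r j)" "n \<le> j" by blast
          then show "z \<in> L2 \<and> ?I z \<in> cball (x t - x0) (e / 2)"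
            using uL N[of j] that by (auto simp: dist_norm norm_minus_commute less_imp_le)
        qed
        then show ?thesis using \<open>0 < e\<close> by (simp add: dist_norm norm_minus_commute)
      qed
      then show "\<exists>N. \<forall>n\<ge>N. norm (?I (v n) - (x t - x0)) < e" by blast
    qed
  qed
  moreover have wU: "w \<in> Uball \<rho>" using w w\<rho> by (simp add: Uball_def)
  ultimately have "x 1 = endpoint x0 F w" using endpoint_eq by metis
  with e have e': "(\<lambda>j. endpoint x0 F (u (r j))) \<longlonglongrightarrow> endpoint x0 F w" by simp
  show ?thesis
  proof (rule that[OF r wU e' d])
    show "d n \<le> (L2norm (u (r n)))\<^sup>2" for n
      by (rule dle) (auto intro: midhull.base)
    show "d j \<le> (L2norm (\<lambda>t. (1/2) *\<^sub>R (u (r m) t + u (r n) t)))\<^sup>2" if "j \<le> m" "j \<le> n" for j m n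
      by (rule dle) (intro midhull.mid midhull.base; use that in auto)
  qed
qed

end

section \<open>Penalized functionals\<close>

lemma zero_in_Uball: "0 \<le> \<rho> \<Longrightarrow> (\<lambda>_. 0) \<in> Uball \<rho>"
  by (simp add: Uball_def L2_def L2norm_def)

lemma half_L2norm_sq_le_Fbeta:
  assumes "0 \<le> \<beta>" "\<forall>x. 0 \<le> a x"
  shows "1/2 * (L2norm u)\<^sup>2 \<le> Fbeta x0 F a \<beta> u"
  using assms by (simp add: Fbeta_def)

lemma penalty_vanishes:
  assumes le: "\<And>j. Fbeta x0 F a (\<beta> j) (u j) \<le> C" and \<beta>: "\<And>j. 0 < \<beta> j" "filterlim \<beta> at_top sequentially"
    and a: "\<forall>x. 0 \<le> a x"
  shows "(\<lambda>j. a (endpoint x0 F (u j))) \<longlonglongrightarrow> 0"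
proof (rule Lim_null_comparison)
  show "(\<lambda>j. C / \<beta> j) \<longlonglongrightarrow> 0"
    by (rule real_tendsto_divide_at_top[OF tendsto_const \<beta>(2)])
  have "norm (a (endpoint x0 F (u j))) \<le> C / \<beta> j" for j
  proof -
    have "\<beta> j * a (endpoint x0 F (u j)) \<le> C"
      using le[of j] zero_le_power2[of "L2norm (u j)"] unfolding Fbeta_def by linarith
    then show ?thesis using \<beta>(1)[of j] a by (simp add: pos_le_divide_eq mult.commute)
  qed
  then show "\<forall>\<^sub>F j in sequentially. norm (a (endpoint x0 F (u j))) \<le> C / \<beta> j"
    by (rule always_eventually[OF allI])
qed

context lipschitz_system begin

lemma Fbeta_minimizer_exists:
  assumes a: "continuous_on UNIV a" "\<forall>x. 0 \<le> a x" and "0 < \<beta>"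
  shows "\<exists>u\<in>Uball \<rho>. \<forall>v\<in>Uball \<rho>. Fbeta x0 F a \<beta> u \<le> Fbeta x0 F a \<beta> v"
proof -
  let ?J = "Fbeta x0 F a \<beta>"
  define m where "m = Inf (?J ` Uball \<rho>)"
  have bdd: "bdd_below (?J ` Uball \<rho>)"
    by (rule bdd_belowI2[of _ 0]) (use a \<open>0 < \<beta>\<close> in \<open>simp add: Fbeta_def\<close>)
  have m: "m \<le> ?J v" if "v \<in> Uball \<rho>" for v
    unfolding m_def by (rule cINF_lower[OF bdd that])
  have "\<exists>u\<in>Uball \<rho>. ?J u < m + inverse (real (Suc j))" for j
  proof -
    have "Inf (?J ` Uball \<rho>) < m + inverse (real (Suc j))" by (simp add: m_def)
    then show ?thesis
      using cINF_less_iff[OF _ bdd] zero_in_Uball[OF \<rho>_nonneg] by blast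
  qed
  then obtain u where u: "\<And>j. u j \<in> Uball \<rho>" and J: "\<And>j. ?J (u j) < m + inverse (real (Suc j))"
    by metis
  obtain r w d where r: "strict_mono (r :: nat \<Rightarrow> nat)" and w: "w \<in> Uball \<rho>"
    and e: "(\<lambda>j. endpoint x0 F (u (r j))) \<longlonglongrightarrow> endpoint x0 F w"
    and d: "d \<longlonglongrightarrow> (L2norm w)\<^sup>2" and dle: "\<And>n. d n \<le> (L2norm (u (r n)))\<^sup>2"
    by (rule control_compactness[of u]) (use u in auto)
  have "(\<lambda>j. a (endpoint x0 F (u (r j)))) \<longlonglongrightarrow> a (endpoint x0 F w)"
    by (rule continuous_on_tendsto_compose[OF a(1) e]) auto
  then have L: "(\<lambda>j. 1/2 * d j + \<beta> * a (endpoint x0 F (u (r j)))) \<longlonglongrightarrow> ?J w"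
    unfolding Fbeta_def by (intro tendsto_intros d)
  have R: "(\<lambda>j. m + inverse (real (Suc (r j)))) \<longlonglongrightarrow> m"
    using LIMSEQ_subseq_LIMSEQ[OF tendsto_add[OF tendsto_const[of m] LIMSEQ_inverse_real_of_nat] r]
    by (simp add: o_def)
  have "1/2 * d j + \<beta> * a (endpoint x0 F (u (r j))) \<le> m + inverse (real (Suc (r j)))" for j
    using J[of "r j"] dle[of j] unfolding Fbeta_def by linarith
  then have "?J w \<le> m"
    using LIMSEQ_le[OF L R] by blast
  then show ?thesis using m w by (meson order_trans)
qed

lemma penalized_compactness:
  assumes a: "continuous_on UNIV a" "\<forall>x. 0 \<le> a x"
    and \<beta>: "\<And>j. 0 < \<beta> j" "filterlim \<beta> at_top sequentially"
    and u: "\<And>j. u j \<in> Uball \<rho>" and le: "\<And>j. Fbeta x0 F a (\<beta> j) (u j) \<le> C"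
  obtains r w d where "strict_mono (r :: nat \<Rightarrow> nat)" "w \<in> Uball \<rho>" "a (endpoint x0 F w) = 0"
    "1/2 * (L2norm w)\<^sup>2 \<le> C" "d \<longlonglongrightarrow> (L2norm w)\<^sup>2"
    "\<And>j m n. j \<le> m \<Longrightarrow> j \<le> n \<Longrightarrow> d j \<le> (L2norm (\<lambda>t. (1/2) *\<^sub>R (u (r m) t + u (r n) t)))\<^sup>2"
proof -
  obtain r w d where r: "strict_mono (r :: nat \<Rightarrow> nat)" and w: "w \<in> Uball \<rho>"
    and e: "(\<lambda>j. endpoint x0 F (u (r j))) \<longlonglongrightarrow> endpoint x0 F w"
    and d: "d \<longlonglongrightarrow> (L2norm w)\<^sup>2" and dle: "\<And>n. d n \<le> (L2norm (u (r n)))\<^sup>2"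
    and mid: "\<And>j m n. j \<le> m \<Longrightarrow> j \<le> n \<Longrightarrow> d j \<le> (L2norm (\<lambda>t. (1/2) *\<^sub>R (u (r m) t + u (r n) t)))\<^sup>2"
    by (rule control_compactness[of u, OF u]) blast
  have "(\<lambda>j. a (endpoint x0 F (u (r j)))) \<longlonglongrightarrow> a (endpoint x0 F w)"
    by (rule continuous_on_tendsto_compose[OF a(1) e]) auto
  moreover have "(\<lambda>j. a (endpoint x0 F (u (r j)))) \<longlonglongrightarrow> 0"
    using LIMSEQ_subseq_LIMSEQ[OF penalty_vanishes[of x0 F a \<beta> u C, OF le \<beta> a(2)] r] by (simp add: o_def)
  ultimately have "a (endpoint x0 F w) = 0" by (rule LIMSEQ_unique)
  moreover have "1/2 * (L2norm w)\<^sup>2 \<le> C"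
  proof (rule LIMSEQ_le_const2[OF tendsto_mult[OF tendsto_const d]])
    have "1/2 * d n \<le> C" for n
      using le[of "r n"] dle[of n] half_L2norm_sq_le_Fbeta[OF less_imp_le[OF \<beta>(1)] a(2), of "u (r n)" x0 F "r n"]
      by linarith
    then show "\<exists>N. \<forall>n\<ge>N. 1/2 * d n \<le> C" by blast
  qed
  ultimately show ?thesis using that r w d mid by blast
qed

end

lemma Fbeta_le_Frho: "ereal (Fbeta x0 F a \<beta> v) \<le> Frho x0 F a v"
  by (simp add: Fbeta_def Frho_def)

theorem mainTheorem20:
  fixes x0 :: "real^'n" and F :: "real^'n \<Rightarrow> real^'k^'n" and a :: "real^'n \<Rightarrow> real"
    and \<rho> :: real
  assumes "\<exists>L. L-lipschitz_on UNIV F"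
    and "continuous_on UNIV a" and "\<forall>x. 0 \<le> a x" and "{x. a x = 0} \<noteq> {}"
    and "\<rho> > 0"
  shows "(((\<lambda>\<beta>. INF u\<in>(Uball \<rho> :: (real \<Rightarrow> real^'k) set). ereal (Fbeta x0 F a \<beta> u))
            \<longlongrightarrow> (INF u\<in>(Uball \<rho> :: (real \<Rightarrow> real^'k) set). Frho x0 F a u)) at_top)
    \<and> (\<forall>\<beta>>0. \<exists>u\<in>Uball \<rho>. \<forall>v\<in>Uball \<rho>. Fbeta x0 F a \<beta> u \<le> Fbeta x0 F a \<beta> v)
    \<and> (\<forall>(uhat :: real \<Rightarrow> real \<Rightarrow> real^'k) (\<beta>s :: nat \<Rightarrow> real).
           (\<exists>u\<in>Uball \<rho>. Frho x0 F a u \<noteq> \<infinity>) \<and>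
           (\<forall>b>0. uhat b \<in> Uball \<rho> \<and> (\<forall>v\<in>Uball \<rho>. Fbeta x0 F a b (uhat b) \<le> Fbeta x0 F a b v)) \<and>
           mono \<beta>s \<and> filterlim \<beta>s at_top sequentially \<and> (\<forall>m. \<beta>s m > 0)
         \<longrightarrow> (\<forall>r :: nat \<Rightarrow> nat. strict_mono r \<longrightarrow> (\<exists>(r' :: nat \<Rightarrow> nat) u. strict_mono r' \<and> u \<in> L2 \<and>
                 (\<lambda>m. L2norm (\<lambda>t. uhat (\<beta>s (r (r' m))) t - u t)) \<longlonglongrightarrow> 0))
           \<and> (\<forall>r u. strict_mono r \<and> u \<in> L2 \<and>
                 (\<lambda>m. L2norm (\<lambda>t. uhat (\<beta>s (r m)) t - u t)) \<longlonglongrightarrow> 0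
               \<longrightarrow> u \<in> Uball \<rho> \<and> (\<forall>v\<in>Uball \<rho>. Frho x0 F a u \<le> Frho x0 F a v)))"
proof -
  note a = assms(2,3)
  obtain L0 where "L0-lipschitz_on UNIV F" using assms(1) by blast
  then have "(max L0 1)-lipschitz_on UNIV F" by (rule lipschitz_on_mono) auto
  then interpret lipschitz_system x0 F "max L0 1" \<rho>
    by unfold_locales (use \<open>\<rho> > 0\<close> in auto)
  let ?U = "Uball \<rho> :: (real \<Rightarrow> real^'k) set"
  let ?g = "\<lambda>\<beta>. INF u\<in>?U. ereal (Fbeta x0 F a \<beta> u)"
  let ?I = "INF u\<in>?U. Frho x0 F a u"
  have g_le: "?g \<beta> \<le> ?I" for \<beta>
    by (rule INF_mono') (rule Fbeta_le_Frho)
  have g_mono: "?g \<beta> \<le> ?g \<beta>'" if "\<beta> \<le> \<beta>'" for \<beta> \<beta>'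
    by (rule INF_mono') (use that a in \<open>auto simp: Fbeta_def intro: mult_right_mono\<close>)
  have "(?g \<longlongrightarrow> ?I) at_top"
  proof (rule order_tendstoI)
    fix y assume "?I < y"
    then show "\<forall>\<^sub>F \<beta> in at_top. ?g \<beta> < y" using g_le by (intro always_eventually) (blast intro: le_less_trans)
  next
    fix y assume "y < ?I"
    then obtain z where z: "y < z" "z < ?I" using dense by blast
    then obtain C where C: "z = ereal C" by (cases z) auto
    have "\<exists>b>0. z \<le> ?g b"
    proof (rule ccontr)
      assume "\<not> (\<exists>b>0. z \<le> ?g b)"
      then have "?g (real (Suc j)) < ereal C" for j
        unfolding C by (metis not_le of_nat_0_less_iff zero_less_Suc)
      then have "\<exists>u\<in>?U. Fbeta x0 F a (real (Suc j)) u \<le> C" for j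
        unfolding INF_less_iff by (auto intro: less_imp_le)
      then obtain u where u: "\<And>j. u j \<in> ?U" and uC: "\<And>j. Fbeta x0 F a (real (Suc j)) (u j) \<le> C"
        by metis
      obtain w where w: "w \<in> ?U" "a (endpoint x0 F w) = 0" "1/2 * (L2norm w)\<^sup>2 \<le> C"
      proof (rule penalized_compactness[of a "\<lambda>j. real (Suc j)" u C])
        show "filterlim (\<lambda>j. real (Suc j)) at_top sequentially"
          by (rule filterlim_compose[OF filterlim_real_sequentially filterlim_Suc])
      qed (use a u uC in auto)
      have "?I \<le> Frho x0 F a w" using w by (intro INF_lower)
      also have "\<dots> \<le> ereal C" using w by (simp add: Frho_def)
      finally show False using z C by simp
    qed
    then obtain b where "z \<le> ?g b" by blast
    then show "\<forall>\<^sub>F \<beta> in at_top. y < ?g \<beta>"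
      using z g_mono by (intro eventually_at_top_linorderI[of b]) (meson less_le_trans order_trans)
  qed
  moreover have "\<forall>\<beta>>0. \<exists>u\<in>?U. \<forall>v\<in>?U. Fbeta x0 F a \<beta> u \<le> Fbeta x0 F a \<beta> v"
    using Fbeta_minimizer_exists[OF a] by blast
  moreover have "(\<exists>r' u. strict_mono (r' :: nat \<Rightarrow> nat) \<and> u \<in> L2 \<and>
        (\<lambda>m. L2norm (\<lambda>t. uhat (\<beta>s (r (r' m))) t - u t)) \<longlonglongrightarrow> 0) \<and>
      (\<forall>u. u \<in> L2 \<and> (\<lambda>m. L2norm (\<lambda>t. uhat (\<beta>s (r m)) t - u t)) \<longlonglongrightarrow> 0
        \<longrightarrow> u \<in> ?U \<and> (\<forall>v\<in>?U. Frho x0 F a u \<le> Frho x0 F a v))"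
    if fin: "\<exists>u\<in>?U. Frho x0 F a u \<noteq> \<infinity>"
      and min: "\<forall>b>0. uhat b \<in> ?U \<and> (\<forall>v\<in>?U. Fbeta x0 F a b (uhat b) \<le> Fbeta x0 F a b v)"
      and \<beta>s: "filterlim \<beta>s at_top sequentially" "\<forall>m. \<beta>s m > 0" and r: "strict_mono (r :: nat \<Rightarrow> nat)"
    for uhat :: "real \<Rightarrow> real \<Rightarrow> real^'k" and \<beta>s :: "nat \<Rightarrow> real" and r
  proof -
    define u where "u m = uhat (\<beta>s (r m))" for m
    have u: "u m \<in> ?U" for m using min \<beta>s by (simp add: u_def)
    then have uL: "u m \<in> L2" for m by (simp add: Uball_def)
    have min': "Fbeta x0 F a (\<beta>s (r m)) (u m) \<le> 1/2 * (L2norm v)\<^sup>2"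
      if v: "v \<in> ?U" "a (endpoint x0 F v) = 0" for v m
    proof -
      have "Fbeta x0 F a (\<beta>s (r m)) (u m) \<le> Fbeta x0 F a (\<beta>s (r m)) v"
        using min \<beta>s v by (simp add: u_def)
      then show ?thesis using v by (simp add: Fbeta_def)
    qed
    have norm_le: "(L2norm (u m))\<^sup>2 \<le> (L2norm v)\<^sup>2"
      if "v \<in> ?U" "a (endpoint x0 F v) = 0" for v m
      using min'[OF that, of m] half_L2norm_sq_le_Fbeta[OF less_imp_le[OF \<beta>s(2)[rule_format]] a(2), of "u m" x0 F "r m"]
      by linarith
    obtain v0 where v0: "v0 \<in> ?U" "a (endpoint x0 F v0) = 0"
      using fin by (auto simp: Frho_def split: if_splits)
    have \<beta>: "filterlim (\<lambda>m. \<beta>s (r m)) at_top sequentially"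
      by (rule filterlim_compose[OF \<beta>s(1) filterlim_subseq[OF r]])
    have "\<exists>r' w. strict_mono (r' :: nat \<Rightarrow> nat) \<and> w \<in> L2 \<and> (\<lambda>m. L2norm (\<lambda>t. u (r' m) t - w t)) \<longlonglongrightarrow> 0"
    proof -
      obtain r' w d where r': "strict_mono (r' :: nat \<Rightarrow> nat)" and w: "w \<in> ?U" "a (endpoint x0 F w) = 0"
        and d: "d \<longlonglongrightarrow> (L2norm w)\<^sup>2"
        and mid: "\<And>j m n. j \<le> m \<Longrightarrow> j \<le> n \<Longrightarrow> d j \<le> (L2norm (\<lambda>t. (1/2) *\<^sub>R (u (r' m) t + u (r' n) t)))\<^sup>2"
        by (rule penalized_compactness[OF a _ \<beta> u min'[OF v0]]) (use \<beta>s in auto)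
      have "\<exists>N. \<forall>m\<ge>N. \<forall>n\<ge>N. L2norm (\<lambda>t. u (r' m) t - u (r' n) t) < e" if "0 < e" for e
        by (rule L2_Cauchy_if_norms[OF uL norm_le[OF w] tendsto_const d mid that])
      then obtain w' where "w' \<in> L2" "(\<lambda>m. L2norm (\<lambda>t. u (r' m) t - w' t)) \<longlonglongrightarrow> 0"
        using L2_complete[of "\<lambda>m. u (r' m)", OF uL] by blast
      with r' show ?thesis by blast
    qed
    moreover have "w \<in> ?U \<and> (\<forall>v\<in>?U. Frho x0 F a w \<le> Frho x0 F a v)"
      if w: "w \<in> L2" and lim: "(\<lambda>m. L2norm (\<lambda>t. u m t - w t)) \<longlonglongrightarrow> 0" for w
    proof -
      obtain r' where r': "strict_mono (r' :: nat \<Rightarrow> nat)"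
        and e: "(\<lambda>j. endpoint x0 F (u (r' j))) \<longlonglongrightarrow> endpoint x0 F w"
        using endpoint_strong_limit[OF u w lim] by blast
      have "(\<lambda>j. a (endpoint x0 F (u (r' j)))) \<longlonglongrightarrow> a (endpoint x0 F w)"
        by (rule continuous_on_tendsto_compose[OF a(1) e]) auto
      moreover have "(\<lambda>j. a (endpoint x0 F (u (r' j)))) \<longlonglongrightarrow> 0"
        using LIMSEQ_subseq_LIMSEQ[OF penalty_vanishes[OF min'[OF v0] _ \<beta> a(2)] r'] \<beta>s
        by (simp add: o_def)
      ultimately have aw: "a (endpoint x0 F w) = 0" by (rule LIMSEQ_unique)
      have "Frho x0 F a w \<le> Frho x0 F a v" if v: "v \<in> ?U" for v
      proof (cases "a (endpoint x0 F v) = 0")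
        case True
        have "(L2norm w)\<^sup>2 \<le> (L2norm v)\<^sup>2"
          by (rule LIMSEQ_le_const2[OF tendsto_power[OF tendsto_L2norm[OF uL w lim]]])
             (use norm_le[OF v True] in blast)
        then show ?thesis using aw True by (simp add: Frho_def)
      qed (simp add: Frho_def)
      then show ?thesis using Uball_strong_limit[OF u w lim] by blast
    qed
    ultimately show ?thesis unfolding u_def by blast
  qed
  ultimately show ?thesis by (intro conjI allI impI) (assumption | blast)+
qed

end
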